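(* Let $G$ be an acyclic finite quiver on $n$ vertices, labeled so that $V_G=\{1,\dots,n\}$ and every edge has the form $j\to i$ with $i<j$. Then $\Omega_n^{\mathrm{op}}(G)=\overline\Omega_n(G)$, i.e. $$\sum_{\sigma\in S_n}c_{n,k(\sigma)}\prod_{\varepsilon\in E_G}\beta_{\varepsilon,-s_\sigma(\varepsilon)}=\sum_{\sigma\in S_n}d_{n,k(\sigma)}\prod_{\varepsilon\in E_G}\beta_{\varepsilon,s_\sigma(\varepsilon)} .$$ In particular, if $G$ is connected, then $\Omega_n^{\mathrm{op}}(G)=\omega_c(G;\boldsymbol\beta)$.
   Context: $c_{n,k}=\frac{(-1)^k}{n\binom{n-1}{k}}$ and $d_{n,k}=\frac{(-1)^{n-1-k}}{n\binom{n-1}{k}}$ for $0\le k\le n-1$. For $\sigma=(\sigma_1,\dots,\sigma_n)\in S_n$: $k(\sigma)=\#\{a\in\{1,\dots,n-1\}:\sigma_a>\sigma_{a+1}\}$; $p_\sigma(i)=\sigma^{-1}(i)$ is the position of $i$ in $\sigma$; for an edge $\varepsilon:j\to i$ with $i<j$, $s_\sigma(\varepsilon)=+$ if $p_\sigma(i)<p_\sigma(j)$ and $s_\sigma(\varepsilon)=-$ if $p_\sigma(i)>p_\sigma(j)$; $-s_\sigma(\varepsilon)$ is the opposite sign. Each edge $\varepsilon$ carries an independent parameter $\beta_\varepsilon$ (over a field of characteristic zero) and $\beta_{\varepsilon,\pm}=(\beta_\varepsilon\pm1)/2$. Here $\Omega_n^{\mathrm{op}}(G):=\sum_{\sigma\in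 S_n}c_{n,k(\sigma)}\prod_{\varepsilon}\beta_{\varepsilon,-s_\sigma(\varepsilon)}$ is the coefficient obtained from operator orderings in the Magnus expansion, and $\overline\Omega_n(G):=\sum_{\sigma\in S_n}d_{n,k(\sigma)}\prod_{\varepsilon}\beta_{\varepsilon,s_\sigma(\varepsilon)}$ is the acyclic master function. Definition of $\omega_c$. A (finite) quiver $G=(V_G,E_G,\rho_G)$ has finite sets $V_G,E_G$ and $\rho_G:E_G\to V_G\times V_G$, where $\rho_G(\varepsilon)=(u,v)$ is written $\varepsilon:u\to v$; parallel edges, directed cycles and tadpoles ($u\to u$) are allowed in general; acyclic means no directed cycle (tadpoles count as directed cycles); connected means nonempty with connected underlying undirected graph. Edges surviving in subquivers/contractions keep their parameters. A cut-subquiver $H\preceq G$ has vertex set $V_G$ and any $E_H\subseteq E_G$; the contraction $G/H$ has vertices the connected components of $H$ and edges $E_G\setminus E_H$ with induced incidences. For tadpole-free $G$, $e_0(G)=|\operatorname{LE}(G)|/|V_G|!$ if $G$ is acyclic ($\operatorname{LE}(G)$ = linear extensions of the partial order induced by the edges), $e_0(G)=0$ otherwise; in general $e(G;\boldsymbol\beta)=\bigl(\prod_{\varepsilon\text{ tadpole}}(-\beta_{\varepsilon,-})\bigr)e_0(G_{\mathrm{pruned}})$ with $G_{\mathrm{pruned}}$ obtained by deleting all tadpoles. $\omega$ is the unique function on quivers with $\sum_{H\preceq G}\omega(H)e(G/H)=\epsilon(G)$, $\epsilon(G)=1$ if $E_G=\emptyset$ and $0$ otherwise; $\omega_c(G)=\omega(G)$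 for connected $G$, and $\omega_c(G)=0$ otherwise. *)

theory Defs
  imports "Graph_Theory.Digraph_Component" "HOL-Combinatorics.Permutations"
begin

text \<open>
  A finite quiver is a \<^locale>\<open>fin_digraph\<close>, which allows loops (tadpoles) and parallel arcs.
  The edge parameters are a function \<open>\<beta>\<close> on the type of edges with values in a field of
  characteristic zero. Hence subquivers and contractions, whose edges are among those of the
  original quiver, keep their parameters automatically.
\<close>

section \<open>The sums over permutations\<close>

text \<open>
  A permutation \<open>(\<sigma>\<^sub>1, \<dots>, \<sigma>\<^sub>n)\<close> is a function \<open>\<sigma>\<close> with \<open>\<sigma> permutes {1..n}\<close>. Signs are the
  integers 1 and -1, so that the opposite sign is the negative.
\<close>

definition c_coeff :: "nat \<Rightarrow> nat \<Rightarrow> 'k::field_char_0" where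
  "c_coeff n k = (-1) ^ k / (of_nat n * of_nat ((n - 1) choose k))"

definition d_coeff :: "nat \<Rightarrow> nat \<Rightarrow> 'k::field_char_0" where
  "d_coeff n k = (-1) ^ (n - 1 - k) / (of_nat n * of_nat ((n - 1) choose k))"

definition num_descents :: "nat \<Rightarrow> (nat \<Rightarrow> nat) \<Rightarrow> nat" where
  "num_descents n \<sigma> = card {a \<in> {1..<n}. \<sigma> a > \<sigma> (a + 1)}"

definition pos :: "(nat \<Rightarrow> nat) \<Rightarrow> nat \<Rightarrow> nat" where
  "pos \<sigma> i = inv \<sigma> i"

definition edge_sign :: "(nat, 'e) pre_digraph \<Rightarrow> (nat \<Rightarrow> nat) \<Rightarrow> 'e \<Rightarrow> int" where
  "edge_sign G \<sigma> \<epsilon> = (if pos \<sigma> (head G \<epsilon>) < pos \<sigma> (tail G \<epsilon>) then 1 else - 1)"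

definition beta_sgn :: "('e \<Rightarrow> 'k::field_char_0) \<Rightarrow> 'e \<Rightarrow> int \<Rightarrow> 'k" where
  "beta_sgn \<beta> \<epsilon> s = (\<beta> \<epsilon> + of_int s) / 2"

definition Omega_op :: "('e \<Rightarrow> 'k::field_char_0) \<Rightarrow> nat \<Rightarrow> (nat, 'e) pre_digraph \<Rightarrow> 'k" where
  "Omega_op \<beta> n G = (\<Sum>\<sigma> | \<sigma> permutes {1..n}.
     c_coeff n (num_descents n \<sigma>) * (\<Prod>\<epsilon>\<in>arcs G. beta_sgn \<beta> \<epsilon> (- edge_sign G \<sigma> \<epsilon>)))"

definition Omega_bar :: "('e \<Rightarrow> 'k::field_char_0) \<Rightarrow> nat \<Rightarrow> (nat, 'e) pre_digraph \<Rightarrow> 'k" where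
  "Omega_bar \<beta> n G = (\<Sum>\<sigma> | \<sigma> permutes {1..n}.
     d_coeff n (num_descents n \<sigma>) * (\<Prod>\<epsilon>\<in>arcs G. beta_sgn \<beta> \<epsilon> (edge_sign G \<sigma> \<epsilon>)))"

section \<open>Contractions and the functions \<open>e\<close> and \<open>\<omega>\<close>\<close>

text \<open>
  The connected components of a quiver are the strongly connected components of the underlying
  undirected graph. The cut-subquivers of \<open>G\<close> are the \<open>H\<close> with \<^term>\<open>spanning H G\<close>.
\<close>

definition contract_quiver ::
    "('v, 'e) pre_digraph \<Rightarrow> ('v, 'e) pre_digraph \<Rightarrow> ('v set, 'e) pre_digraph" where
  "contract_quiver G H =
     \<lparr> verts = pre_digraph.sccs_verts (with_proj (mk_symmetric H)),
       arcs = arcs G - arcs H,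
       tail = (\<lambda>\<epsilon>. pre_digraph.scc_of (with_proj (mk_symmetric H)) (tail G \<epsilon>)),
       head = (\<lambda>\<epsilon>. pre_digraph.scc_of (with_proj (mk_symmetric H)) (head G \<epsilon>)) \<rparr>"

definition acyclic_quiver :: "('v, 'e) pre_digraph \<Rightarrow> bool" where
  "acyclic_quiver G \<longleftrightarrow> \<not> (\<exists>p. pre_digraph.cycle G p)"

text \<open>
  The head of an edge precedes its tail, in accordance with labelings in which every edge has the
  form \<open>j \<rightarrow> i\<close> with \<open>i < j\<close>. The number of linear extensions is the same for the reversed order.
\<close>

definition edge_order :: "('v, 'e) pre_digraph \<Rightarrow> 'v rel" where
  "edge_order G = {(v, u). u \<rightarrow>\<^sup>*\<^bsub>G\<^esub> v}"

definition linear_extensions :: "('v, 'e) pre_digraph \<Rightarrow> 'v rel set" where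
  "linear_extensions G = {r. linear_order_on (verts G) r \<and> edge_order G \<subseteq> r}"

definition e0 :: "('v, 'e) pre_digraph \<Rightarrow> 'k::field_char_0" where
  "e0 G = (if acyclic_quiver G
           then of_nat (card (linear_extensions G)) / fact (card (verts G)) else 0)"

definition tadpoles :: "('v, 'e) pre_digraph \<Rightarrow> 'e set" where
  "tadpoles G = {\<epsilon> \<in> arcs G. tail G \<epsilon> = head G \<epsilon>}"

definition prune :: "('v, 'e) pre_digraph \<Rightarrow> ('v, 'e) pre_digraph" where
  "prune G = G \<lparr> arcs := arcs G - tadpoles G \<rparr>"

definition e_quiver :: "('e \<Rightarrow> 'k::field_char_0) \<Rightarrow> ('v, 'e) pre_digraph \<Rightarrow> 'k" where
  "e_quiver \<beta> G = (\<Prod>\<epsilon>\<in>tadpoles G. - beta_sgn \<beta> \<epsilon> (- 1)) * e0 (prune G)"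

definition counit :: "('v, 'e) pre_digraph \<Rightarrow> 'k::field_char_0" where
  "counit G = (if arcs G = {} then 1 else 0)"

text \<open>
  Records that are not finite quivers are given the value 0. This only serves to make the function
  unique on the whole type; see \<open>ex1_omega\<close> below.
\<close>

definition is_omega ::
    "('e \<Rightarrow> 'k::field_char_0) \<Rightarrow> (('v, 'e) pre_digraph \<Rightarrow> 'k) \<Rightarrow> bool" where
  "is_omega \<beta> w \<longleftrightarrow>
     (\<forall>G. fin_digraph G \<longrightarrow>
        (\<Sum>H | spanning H G. w H * e_quiver \<beta> (contract_quiver G H)) = counit G) \<and>
     (\<forall>G. \<not> fin_digraph G \<longrightarrow> w G = 0)"

definition omega :: "('e \<Rightarrow> 'k::field_char_0) \<Rightarrow> ('v, 'e) pre_digraph \<Rightarrow> 'k" where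
  "omega \<beta> = (THE w. is_omega \<beta> w)"

definition omega_c :: "('e \<Rightarrow> 'k::field_char_0) \<Rightarrow> ('v, 'e) pre_digraph \<Rightarrow> 'k" where
  "omega_c \<beta> G = (if connected G then omega \<beta> G else 0)"

section \<open>Existence and uniqueness of \<open>\<omega>\<close>\<close>

lemma spanning_refl: "fin_digraph G \<Longrightarrow> spanning G G"
  by (simp add: spanning_def fin_digraph_def wf_digraph.subgraph_refl)

lemma spanning_fin_digraph: "fin_digraph G \<Longrightarrow> spanning H G \<Longrightarrow> fin_digraph H"
  by (auto simp: spanning_def intro: fin_digraph.fin_digraph_subgraph)

lemma spanning_eq_update: "spanning H G \<Longrightarrow> H = G \<lparr> arcs := arcs H \<rparr>"
  by (cases G; cases H) (auto simp: spanning_def subgraph_def compatible_def)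

lemma finite_spanning:
  assumes "fin_digraph G"
  shows "finite {H. spanning H G}"
proof (rule finite_subset)
  show "{H. spanning H G} \<subseteq> (\<lambda>F. G \<lparr> arcs := F \<rparr>) ` Pow (arcs G)"
  proof
    fix H assume "H \<in> {H. spanning H G}"
    then have H: "spanning H G" by simp
    then have "arcs H \<in> Pow (arcs G)" by (auto simp: spanning_def subgraph_def)
    with spanning_eq_update[OF H] show "H \<in> (\<lambda>F. G \<lparr> arcs := F \<rparr>) ` Pow (arcs G)"
      by (rule image_eqI)
  qed
  show "finite ((\<lambda>F. G \<lparr> arcs := F \<rparr>) ` Pow (arcs G))"
    using assms by (simp add: fin_digraph.finite_arcs)
qed

lemma spanning_card_less:
  assumes "fin_digraph G" "spanning H G" "H \<noteq> G"
  shows "card (arcs H) < card (arcs G)"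
proof -
  have "arcs H \<subseteq> arcs G" using assms(2) by (auto simp: spanning_def subgraph_def)
  moreover have "arcs H \<noteq> arcs G" 
  proof
    assume "arcs H = arcs G"
    with spanning_eq_update[OF assms(2)] have "H = G \<lparr> arcs := arcs G \<rparr>" by simp
    then show False using assms(3) by simp
  qed
  ultimately show ?thesis
    using fin_digraph.finite_arcs[OF assms(1)] by (simp add: psubset_card_mono psubsetI)
qed

lemma finite_components:
  assumes "fin_digraph H"
  shows "finite (pre_digraph.sccs_verts (with_proj (mk_symmetric H)))"
proof (rule finite_subset)
  show "pre_digraph.sccs_verts (with_proj (mk_symmetric H)) \<subseteq> Pow (verts H)"
  proof
    fix S assume "S \<in> pre_digraph.sccs_verts (with_proj (mk_symmetric H))"
    then have "u \<rightarrow>\<^sup>*\<^bsub>with_proj (mk_symmetric H)\<^esub> u" if "u \<in> S" for u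
      using that by (simp add: pre_digraph.sccs_verts_def)
    then show "S \<in> Pow (verts H)" by (fastforce elim: reachable_in_vertsE)
  qed
  show "finite (Pow (verts H))" using assms by (simp add: fin_digraph.finite_verts)
qed

lemma e0_arcless_nonzero:
  assumes "finite (verts G)" "arcs G = {}"
  shows "e0 G \<noteq> (0::'k::field_char_0)"
proof -
  have acy: "acyclic_quiver G"
    using assms(2)
    by (auto simp: acyclic_quiver_def pre_digraph.cycle_def pre_digraph.awalk_def
        neq_Nil_conv)
  have ord: "edge_order G \<subseteq> {(v, v) |v. v \<in> verts G}"
  proof -
    have "u = v \<and> u \<in> verts G" if "u \<rightarrow>\<^sup>*\<^bsub>G\<^esub> v" for u v
      using that assms(2) reachable_rtranclI[OF that]
      by (auto simp: arcs_ends_def elim: reachable_in_vertsE)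
    then show ?thesis by (auto simp: edge_order_def)
  qed
  obtain r where r: "well_order_on (verts G) r" using well_order_on by blast
  then have "linear_order_on (verts G) r" by (simp add: well_order_on_def)
  then have "r \<in> linear_extensions G"
    using ord by (auto simp: linear_extensions_def order_on_defs refl_on_def)
  moreover have "finite (linear_extensions G)"
    using assms(1)
    by (auto simp: linear_extensions_def order_on_defs
        intro!: finite_subset[of _ "Pow (verts G \<times> verts G)"])
  ultimately have "card (linear_extensions G) \<noteq> 0" by auto
  then show ?thesis using acy by (simp add: e0_def)
qed

lemma e_quiver_contract_self_nonzero:
  assumes "fin_digraph G"
  shows "e_quiver \<beta> (contract_quiver G G) \<noteq> 0"
  unfolding e_quiver_def
  by (simp add: contract_quiver_def tadpoles_def prune_def e0_arcless_nonzero
      finite_components[OF assms])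

function omega_rec :: "('e \<Rightarrow> 'k::field_char_0) \<Rightarrow> ('v, 'e) pre_digraph \<Rightarrow> 'k" where
  "omega_rec \<beta> G = (if fin_digraph G
     then (counit G - (\<Sum>H\<in>{H. spanning H G \<and> H \<noteq> G}.
             omega_rec \<beta> H * e_quiver \<beta> (contract_quiver G H))) /
          e_quiver \<beta> (contract_quiver G G)
     else 0)"
  by pat_completeness auto
termination
  by (relation "measure (\<lambda>(\<beta>, G). card (arcs G))") (auto intro: spanning_card_less)

declare omega_rec.simps [simp del]

lemma sum_spanning_split:
  fixes f :: "('v, 'e) pre_digraph \<Rightarrow> 'k::field_char_0"
  assumes "fin_digraph G"
  shows "(\<Sum>H | spanning H G. f H) = f G + (\<Sum>H\<in>{H. spanning H G \<and> H \<noteq> G}. f H)"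
proof -
  have "{H. spanning H G \<and> H \<noteq> G} = {H. spanning H G} - {G}" by auto
  then show ?thesis
    using finite_spanning[OF assms] spanning_refl[OF assms]
    by (simp add: sum.remove[of _ G])
qed

lemma is_omega_omega_rec:
  fixes \<beta> :: "'e \<Rightarrow> 'k::field_char_0"
  shows "is_omega \<beta> (omega_rec \<beta> :: ('v, 'e) pre_digraph \<Rightarrow> 'k)"
proof -
  have "(\<Sum>H | spanning H G. omega_rec \<beta> H * e_quiver \<beta> (contract_quiver G H)) = counit G"
    if G: "fin_digraph G" for G :: "('v, 'e) pre_digraph"
    using G e_quiver_contract_self_nonzero[OF G, of \<beta>]
    by (subst sum_spanning_split[OF G], subst omega_rec.simps) simp
  then show ?thesis by (auto simp: is_omega_def omega_rec.simps)
qed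

lemma is_omega_unique:
  fixes G :: "('v, 'e) pre_digraph" and \<beta> :: "'e \<Rightarrow> 'k::field_char_0"
  assumes "is_omega \<beta> w" "is_omega \<beta> w'"
  shows "w G = w' G"
proof (induction "card (arcs G)" arbitrary: G rule: less_induct)
  case less
  show ?case
  proof (cases "fin_digraph G")
    case True
    have "(\<Sum>H\<in>{H. spanning H G \<and> H \<noteq> G}. w H * e_quiver \<beta> (contract_quiver G H)) =
          (\<Sum>H\<in>{H. spanning H G \<and> H \<noteq> G}. w' H * e_quiver \<beta> (contract_quiver G H))"
      using less True by (intro sum.cong) (auto dest: spanning_card_less)
    moreover have
      "(\<Sum>H | spanning H G. w H * e_quiver \<beta> (contract_quiver G H)) =
       (\<Sum>H | spanning H G. w' H * e_quiver \<beta> (contract_quiver G H))"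
      using assms True by (simp add: is_omega_def)
    ultimately show ?thesis
      using e_quiver_contract_self_nonzero[OF True, of \<beta>]
      by (simp add: sum_spanning_split[OF True])
  next
    case False
    then show ?thesis using assms by (simp add: is_omega_def)
  qed
qed

theorem ex1_omega: "\<exists>!w. is_omega \<beta> w"
  using is_omega_omega_rec is_omega_unique by (blast intro: ext)

corollary is_omega_omega: "is_omega \<beta> (omega \<beta>)"
  unfolding omega_def by (rule theI'[OF ex1_omega])

end

theory Submission
  imports Defs "HOL-Computational_Algebra.Polynomial"
begin

text \<open>
  Write \<open>b\<^sub>\<epsilon>\<close> for \<open>\<beta>\<^sub>\<epsilon>\<^sub>,\<^sub>-\<close>, so that \<open>\<beta>\<^sub>\<epsilon>\<^sub>,\<^sub>+ = b\<^sub>\<epsilon> + 1\<close>, and \<open>[N]\<close> for \<open>{0,\<dots>,N - 1}\<close>. Everything is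
  read off from one polynomial attached to a finite quiver \<open>G\<close>,
    \<open>P\<^sub>G(N) = \<Sum>f : V\<^sub>G \<rightarrow> [N]. \<Prod>\<epsilon>. (b\<^sub>\<epsilon> + [f(tail \<epsilon>) < f(head \<epsilon>)])\<close>,
  a deformation of the strict order polynomial, which is the case \<open>b = 0\<close> and is called \<open>S\<^sub>G\<close>
  here. Such a sum is polynomial in \<open>N\<close> because its summand depends on \<open>f\<close> only through the weak
  order that \<open>f\<close> induces on the vertices.

  For every finite quiver \<open>G\<close>, the value \<open>\<omega>(G)\<close> is the coefficient of \<open>N\<^sup>c\<close> in \<open>P\<^sub>G\<close>, where \<open>c\<close> is
  the number of connected components of \<open>G\<close>. To see this, let
    \<open>Q\<^sub>K(M) = \<Sum>g : V\<^sub>K \<rightarrow> [M]. \<Prod>\<epsilon>. ([g(tail \<epsilon>) < g(head \<epsilon>)] - b\<^sub>\<epsilon> [g(tail \<epsilon>) = g(head \<epsilon>)])\<close>.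
  For a map \<open>\<phi> = (f, g)\<close> into \<open>[M] \<times> [N]\<close> with the lexicographic order, the indicator of
  \<open>\<phi>(tail \<epsilon>) < \<phi>(head \<epsilon>)\<close> is the sum of \<open>[f\<^sub>t = f\<^sub>h] (b\<^sub>\<epsilon> + [g\<^sub>t < g\<^sub>h])\<close> and
  \<open>[f\<^sub>t < f\<^sub>h] - b\<^sub>\<epsilon> [f\<^sub>t = f\<^sub>h]\<close>, with \<open>t\<close> and \<open>h\<close> the tail and head of \<open>\<epsilon>\<close>. Expanding the product
  over all edges gives
    \<open>S\<^sub>G(M N) = \<Sum>H. Q\<^bsub>G/H\<^esub>(M) P\<^sub>H(N)\<close>   (lemma \<open>sum_contr_times_cut\<close>).
  Compare the coefficients of \<open>M\<^sup>c N\<^sup>c\<close>. The polynomial \<open>P\<^sub>H\<close> is a product over the components of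
  \<open>H\<close> of polynomials without constant term, so it is divisible by \<open>N\<^sup>c\<close> with \<open>c\<close> the number of
  components of \<open>H\<close> (\<open>coeff_cut_poly_low\<close>). This \<open>c\<close> is also the number of vertices of \<open>G/H\<close>, so it
  bounds the degree of \<open>Q\<^bsub>G/H\<^esub>\<close>, whose coefficient of that degree is \<open>e(G/H)\<close>
  (\<open>coeff_contr_poly_top\<close>). Hence only the summands \<open>H\<close> with exactly \<open>c\<close> components contribute for a
  given \<open>c\<close>, and adding up over \<open>c\<close> yields
  \<open>\<Sum>H. e(G/H) [N\<^sup>c]P\<^sub>H = S\<^sub>G(1) = \<epsilon>(G)\<close>, the relation that defines \<open>\<omega>\<close> (\<open>is_omega_cut_poly\<close>).

  For a connected quiver with edges \<open>j \<rightarrow> i\<close>, \<open>i < j\<close>, it remains to identify the linear coefficient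
  of \<open>P\<^sub>G\<close>. Sort the vertices by \<open>f\<close>, ties being broken by the labels. The maps with a given sorting
  permutation \<open>\<sigma>\<close> all have the weight \<open>\<Prod>\<epsilon>. \<beta>\<^bsub>\<epsilon>,-s(\<epsilon>)\<^esub>\<close>, and there are \<open>N + n - 1 - k(\<sigma>)\<close> choose \<open>n\<close> of
  them (\<open>card_sorted_by\<close>), a polynomial in \<open>N\<close> with linear coefficient \<open>c\<^bsub>n,k(\<sigma>)\<^esub>\<close>
  (\<open>coeff_sort_poly_1\<close>). The equality of the two sums over permutations is seen by reversing all
  permutations: this exchanges ascents with descents and flips all signs.
\<close>

section \<open>Sums over maps that depend only on the induced weak order\<close>

text \<open>
  The summand \<open>w f\<close> depends only on the weak order that \<open>f\<close> induces on \<open>V\<close>; in particular it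
  depends only on the values of \<open>f\<close> on \<open>V\<close>.
\<close>

definition order_invariant :: "'v set \<Rightarrow> (('v \<Rightarrow> nat) \<Rightarrow> 'k) \<Rightarrow> bool" where
  "order_invariant V w \<longleftrightarrow>
     (\<forall>f g. (\<forall>x\<in>V. \<forall>y\<in>V. f x < f y \<longleftrightarrow> g x < g y) \<longrightarrow> w f = w g)"

text \<open>
  The sum of \<open>w\<close> over the maps from \<open>V\<close> onto \<open>{0,\<dots>,m - 1}\<close>. Functions on \<open>V\<close> are represented by
  their extensions with value \<open>undefined\<close> outside \<open>V\<close>.
\<close>

definition surj_sum :: "'v set \<Rightarrow> (('v \<Rightarrow> nat) \<Rightarrow> 'k::field_char_0) \<Rightarrow> nat \<Rightarrow> 'k" where
  "surj_sum V w m = (\<Sum>f | f \<in> V \<rightarrow>\<^sub>E {..<m} \<and> f ` V = {..<m}. w f)"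

text \<open>
  The binomial coefficient \<open>x choose m\<close> as a polynomial in \<open>x\<close>.
\<close>

definition binom_poly :: "nat \<Rightarrow> 'k::field_char_0 poly" where
  "binom_poly m = smult (1 / fact m) (\<Prod>i<m. [:- of_nat i, 1:])"

text \<open>
  The polynomial with the values \<open>\<Sum>f : V \<rightarrow> {0,\<dots>,N - 1}. w f\<close>, obtained by grouping the maps \<open>f\<close> by
  their image: an image with \<open>m\<close> elements can be chosen in \<open>N choose m\<close> ways and relabelled as
  \<open>{0,\<dots>,m - 1}\<close>.
\<close>

definition count_poly :: "'v set \<Rightarrow> (('v \<Rightarrow> nat) \<Rightarrow> 'k::field_char_0) \<Rightarrow> 'k poly" where
  "count_poly V w = (\<Sum>m\<le>card V. smult (surj_sum V w m) (binom_poly m))"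

lemma order_invariantD:
  "order_invariant V w \<Longrightarrow> (\<And>x y. x \<in> V \<Longrightarrow> y \<in> V \<Longrightarrow> f x < f y \<longleftrightarrow> g x < g y) \<Longrightarrow> w f = w g"
  by (auto simp: order_invariant_def)

lemma poly_binom_poly_of_nat: "poly (binom_poly m) (of_nat N) = of_nat (N choose m)"
  by (simp add: binom_poly_def poly_prod binomial_gbinomial gbinomial_prod_rev
      atLeast0LessThan)

lemma degree_binom_prod: "degree (\<Prod>i<m. [:- of_nat i, 1::'k::field_char_0:]) = m"
  by (subst degree_prod_sum_eq) simp_all

lemma degree_binom_poly [simp]: "degree (binom_poly m :: 'k::field_char_0 poly) = m"
  by (simp add: binom_poly_def degree_binom_prod)

lemma coeff_binom_poly_top: "coeff (binom_poly m :: 'k::field_char_0 poly) m = 1 / fact m"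
proof -
  have "lead_coeff (\<Prod>i<m. [:- of_nat i, 1::'k:]) = 1"
    by (simp add: lead_coeff_prod)
  then show ?thesis
    by (simp add: binom_poly_def degree_binom_prod)
qed

lemma poly_eqI_of_nat:
  fixes p q :: "'k::field_char_0 poly"
  assumes "\<And>N. poly p (of_nat N) = poly q (of_nat N)"
  shows "p = q"
proof (rule ccontr)
  assume "p \<noteq> q"
  then have "finite {x. poly (p - q) x = 0}"
    by (intro poly_roots_finite) simp
  moreover have "range of_nat \<subseteq> {x. poly (p - q) x = 0}"
    using assms by auto
  ultimately have "finite (range (of_nat :: nat \<Rightarrow> 'k))"
    by (rule finite_subset[rotated])
  then show False
    using finite_imageD[of "of_nat :: nat \<Rightarrow> 'k" UNIV] inj_of_nat by auto
qed

lemma surj_sum_eq_0: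
  fixes V :: "'v set"
  assumes "finite V" "card V < m"
  shows "surj_sum V w m = 0"
proof -
  have "f ` V \<noteq> {..<m}" for f :: "'v \<Rightarrow> nat"
  proof
    assume "f ` V = {..<m}"
    then have "card (f ` V) = m" by simp
    then show False using card_image_le[OF assms(1), of f] assms(2) by simp
  qed
  then have "{f. f \<in> V \<rightarrow>\<^sub>E {..<m} \<and> f ` V = {..<m}} = {}" by auto
  then show ?thesis by (simp only: surj_sum_def sum.empty)
qed

lemma sum_onto_eq_surj_sum:
  assumes inv: "order_invariant V w" and "finite A"
  shows "(\<Sum>f | f \<in> V \<rightarrow>\<^sub>E A \<and> f ` V = A. w f) = surj_sum V w (card A)"
proof -
  obtain h where h: "bij_betw h {..<card A} A" and mono: "strict_mono_on {..<card A} h"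
    using ex_bij_betw_strict_mono_card[OF \<open>finite A\<close>] .
  let ?h' = "inv_into {..<card A} h"
  have h': "bij_betw ?h' A {..<card A}" by (rule bij_betw_inv_into[OF h])
  have less: "h a < h b \<longleftrightarrow> a < b" if "a < card A" "b < card A" for a b
    using strict_mono_on_less[OF mono] that by simp
  show ?thesis
    unfolding surj_sum_def
  proof (rule sum.reindex_bij_witness[where i = "\<lambda>f. \<lambda>x\<in>V. h (f x)" and j = "\<lambda>f. \<lambda>x\<in>V. ?h' (f x)"])
    fix f assume f: "f \<in> {f. f \<in> V \<rightarrow>\<^sub>E A \<and> f ` V = A}"
    then have fV: "f x \<in> A" if "x \<in> V" for x using that by auto
    show "(\<lambda>x\<in>V. h ((\<lambda>x\<in>V. ?h' (f x)) x)) = f"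
      using f fV by (auto simp: fun_eq_iff restrict_def PiE_def extensional_def
          bij_betw_inv_into_right[OF h])
    have "(\<lambda>x. ?h' (f x)) ` V = ?h' ` A" using f by (auto simp: image_image[symmetric])
    then have im: "(\<lambda>x. ?h' (f x)) ` V = {..<card A}"
      using h' by (simp add: bij_betw_def)
    then show "(\<lambda>x\<in>V. ?h' (f x)) \<in> {f. f \<in> V \<rightarrow>\<^sub>E {..<card A} \<and> f ` V = {..<card A}}"
      by auto
    show "w (\<lambda>x\<in>V. ?h' (f x)) = w f"
    proof (rule order_invariantD[OF inv])
      fix x y assume "x \<in> V" "y \<in> V"
      moreover from this have "?h' (f x) < card A" "?h' (f y) < card A"
        using im by auto
      ultimately show "(\<lambda>x\<in>V. ?h' (f x)) x < (\<lambda>x\<in>V. ?h' (f x)) y \<longleftrightarrow> f x < f y"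
        using less[of "?h' (f x)" "?h' (f y)"] fV by (simp add: bij_betw_inv_into_right[OF h])
    qed
  next
    fix f assume f: "f \<in> {f. f \<in> V \<rightarrow>\<^sub>E {..<card A} \<and> f ` V = {..<card A}}"
    then have fV: "f x < card A" if "x \<in> V" for x using that by auto
    show "(\<lambda>x\<in>V. ?h' ((\<lambda>x\<in>V. h (f x)) x)) = f"
      using f fV by (auto simp: fun_eq_iff restrict_def PiE_def extensional_def
          bij_betw_inv_into_left[OF h])
    have "(\<lambda>x. h (f x)) ` V = h ` {..<card A}" using f by (auto simp: image_image[symmetric])
    then have "(\<lambda>x. h (f x)) ` V = A"
      using h by (simp add: bij_betw_def)
    then show "(\<lambda>x\<in>V. h (f x)) \<in> {f. f \<in> V \<rightarrow>\<^sub>E A \<and> f ` V = A}"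
      by auto
  qed
qed

lemma poly_count_poly:
  fixes w :: "('v \<Rightarrow> nat) \<Rightarrow> 'k::field_char_0"
  assumes fin: "finite V" and inv: "order_invariant V w"
  shows "poly (count_poly V w) (of_nat N) = (\<Sum>f\<in>V \<rightarrow>\<^sub>E {..<N}. w f)"
proof -
  let ?F = "V \<rightarrow>\<^sub>E {..<N}" and ?K = "{..max N (card V)}"
  have "(\<Sum>f\<in>?F. w f) = (\<Sum>A\<in>Pow {..<N}. \<Sum>f | f \<in> ?F \<and> f ` V = A. w f)"
    using fin by (intro sum.group[symmetric]) (auto intro: finite_PiE)
  also have "\<dots> = (\<Sum>A\<in>Pow {..<N}. surj_sum V w (card A))"
  proof (rule sum.cong[OF refl])
    fix A :: "nat set" assume A: "A \<in> Pow {..<N}"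
    then have "{f. f \<in> ?F \<and> f ` V = A} = {f. f \<in> V \<rightarrow>\<^sub>E A \<and> f ` V = A}"
      by (auto simp: PiE_def Pi_def)
    then show "(\<Sum>f | f \<in> ?F \<and> f ` V = A. w f) = surj_sum V w (card A)"
      using sum_onto_eq_surj_sum[OF inv, of A] A finite_subset[of A "{..<N}"] by simp
  qed
  \<comment> \<open>All cardinalities up to the larger of \<open>N\<close> and \<open>card V\<close> are admitted, so that both the
  subsets of \<open>{..<N}\<close> and the summands of \<open>count_poly\<close> are covered; the extra terms vanish.\<close>
  also have "\<dots> = (\<Sum>m\<in>?K. \<Sum>A | A \<in> Pow {..<N} \<and> card A = m. surj_sum V w (card A))"
  proof (rule sum.group[symmetric])
    have "card A \<le> N" if "A \<subseteq> {..<N}" for A :: "nat set"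
      using card_mono[OF _ that] by simp
    then show "card ` Pow {..<N} \<subseteq> ?K" by (auto simp: le_max_iff_disj)
  qed auto
  also have "\<dots> = (\<Sum>m\<in>?K. of_nat (N choose m) * surj_sum V w m)"
  proof (rule sum.cong[OF refl])
    fix m
    have "card {A. A \<subseteq> {..<N} \<and> card A = m} = N choose m"
      using n_subsets[of "{..<N}" m] by simp
    then show "(\<Sum>A | A \<in> Pow {..<N} \<and> card A = m. surj_sum V w (card A)) =
        of_nat (N choose m) * surj_sum V w m"
      by simp
  qed
  also have "\<dots> = (\<Sum>m\<le>card V. of_nat (N choose m) * surj_sum V w m)"
    by (rule sum.mono_neutral_right) (auto simp: surj_sum_eq_0[OF fin])
  also have "\<dots> = poly (count_poly V w) (of_nat N)"
    by (simp add: count_poly_def poly_sum poly_binom_poly_of_nat mult.commute)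
  finally show ?thesis by simp
qed

lemma degree_count_poly_le: "degree (count_poly V w) \<le> card V"
  unfolding count_poly_def
  by (rule degree_sum_le) (auto intro: order.trans[OF degree_smult_le])

lemma coeff_count_poly_card:
  "coeff (count_poly V w) (card V) = surj_sum V w (card V) / fact (card V)"
proof -
  have "coeff (count_poly V w) (card V) =
      (\<Sum>m\<le>card V. surj_sum V w m * coeff (binom_poly m) (card V))"
    by (simp add: count_poly_def coeff_sum)
  also have "\<dots> = (\<Sum>m\<in>{card V}. surj_sum V w m * coeff (binom_poly m) (card V))"
    by (rule sum.mono_neutral_right) (auto intro!: coeff_eq_0)
  finally show ?thesis by (simp add: coeff_binom_poly_top)
qed

section \<open>Sums over maps on disjoint unions\<close>

lemma sum_PiE_Un_disjoint:
  fixes u v :: "('v \<Rightarrow> 'b) \<Rightarrow> 'k::comm_semiring_0"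
  assumes disj: "A \<inter> B = {}"
    and u: "\<And>f g. (\<And>x. x \<in> A \<Longrightarrow> f x = g x) \<Longrightarrow> u f = u g"
    and v: "\<And>f g. (\<And>x. x \<in> B \<Longrightarrow> f x = g x) \<Longrightarrow> v f = v g"
  shows "(\<Sum>f\<in>A \<union> B \<rightarrow>\<^sub>E T. u f * v f) = (\<Sum>f\<in>A \<rightarrow>\<^sub>E T. u f) * (\<Sum>f\<in>B \<rightarrow>\<^sub>E T. v f)"
proof -
  have "(\<Sum>f\<in>A \<union> B \<rightarrow>\<^sub>E T. u f * v f) =
      (\<Sum>(f, g)\<in>(A \<rightarrow>\<^sub>E T) \<times> (B \<rightarrow>\<^sub>E T). u f * v g)"
  proof (rule sum.reindex_bij_witness[where i = "\<lambda>(f, g) x. if x \<in> A then f x else g x"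
        and j = "\<lambda>f. (restrict f A, restrict f B)"], goal_cases)
    case (1 f)
    then show ?case by (auto simp: fun_eq_iff PiE_def extensional_def)
  next
    case (2 f)
    then show ?case by auto
  next
    case (3 p)
    then obtain f g where p: "p = (f, g)" "f \<in> A \<rightarrow>\<^sub>E T" "g \<in> B \<rightarrow>\<^sub>E T" by auto
    have "(if x \<in> B then (if x \<in> A then f x else g x) else undefined) = g x" for x
      using p(3) disj by (auto simp: PiE_def extensional_def)
    moreover have "(if x \<in> A then (if x \<in> A then f x else g x) else undefined) = f x" for x
      using p(2) by (auto simp: PiE_def extensional_def)
    ultimately show ?case unfolding p(1) prod.case restrict_def by simp
  next
    case (4 p)
    then show ?case by (auto simp: PiE_def extensional_def Pi_def)
  next
    case (5 f)
    have "u (restrict f A) = u f" "v (restrict f B) = v f" by (auto intro!: u v)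
    then show ?case by simp
  qed
  then show ?thesis by (simp add: sum_product sum.cartesian_product)
qed

text \<open>
  A sum over maps on a disjoint union factorizes if the summand is a product of functions of the
  restrictions to the parts.
\<close>

lemma sum_PiE_Union_disjoint:
  fixes w :: "'v set \<Rightarrow> ('v \<Rightarrow> 'b) \<Rightarrow> 'k::comm_semiring_1"
  assumes "finite K" "pairwise disjnt K"
    and "\<And>C f g. C \<in> K \<Longrightarrow> (\<And>x. x \<in> C \<Longrightarrow> f x = g x) \<Longrightarrow> w C f = w C g"
  shows "(\<Sum>f\<in>\<Union>K \<rightarrow>\<^sub>E T. \<Prod>C\<in>K. w C f) = (\<Prod>C\<in>K. \<Sum>f\<in>C \<rightarrow>\<^sub>E T. w C f)"
  using assms
proof (induction K rule: finite_induct)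
  case empty
  then show ?case by simp
next
  case (insert C K)
  have "(\<Sum>f\<in>C \<union> \<Union>K \<rightarrow>\<^sub>E T. w C f * (\<Prod>D\<in>K. w D f)) =
      (\<Sum>f\<in>C \<rightarrow>\<^sub>E T. w C f) * (\<Sum>f\<in>\<Union>K \<rightarrow>\<^sub>E T. \<Prod>D\<in>K. w D f)"
  proof (rule sum_PiE_Un_disjoint)
    show "C \<inter> \<Union>K = {}"
      using insert.prems(1) insert.hyps(2) unfolding pairwise_insert disjnt_def by blast
    show "w C f = w C g" if "\<And>x. x \<in> C \<Longrightarrow> f x = g x" for f g
      by (rule insert.prems(2)) (use that in auto)
    show "(\<Prod>D\<in>K. w D f) = (\<Prod>D\<in>K. w D g)" if "\<And>x. x \<in> \<Union>K \<Longrightarrow> f x = g x" for f g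
      by (rule prod.cong[OF refl], rule insert.prems(2)) (use that in auto)
  qed
  moreover have "(\<Sum>f\<in>\<Union>K \<rightarrow>\<^sub>E T. \<Prod>D\<in>K. w D f) = (\<Prod>D\<in>K. \<Sum>f\<in>D \<rightarrow>\<^sub>E T. w D f)"
    using insert.prems(1) by (intro insert.IH insert.prems(2)) (auto simp: pairwise_insert)
  ultimately show ?case
    using insert.hyps by simp
qed

section \<open>Connected components\<close>

text \<open>
  The connected components are, as in the contraction, the strongly connected components of the
  underlying undirected graph.
\<close>

abbreviation components :: "('v, 'e) pre_digraph \<Rightarrow> 'v set set" where
  "components H \<equiv> pre_digraph.sccs_verts (with_proj (mk_symmetric H))"

abbreviation component_of :: "('v, 'e) pre_digraph \<Rightarrow> 'v \<Rightarrow> 'v set" where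
  "component_of H \<equiv> pre_digraph.scc_of (with_proj (mk_symmetric H))"

context wf_digraph
begin

lemma wf_mk_symmetric: "wf_digraph (with_proj (mk_symmetric G))"
  using wellformed_mk_symmetric by (simp add: wf_digraph_wp_iff)

lemma components_eq_image: "components G = component_of G ` verts G"
  using wf_digraph.sccs_verts_conv_scc_of[OF wf_mk_symmetric] by simp

lemma in_component_of_self: "u \<in> verts G \<Longrightarrow> u \<in> component_of G u"
  using wf_digraph.in_scc_of_self[OF wf_mk_symmetric] by simp

lemma component_of_in_components: "u \<in> verts G \<Longrightarrow> component_of G u \<in> components G"
  by (simp add: components_eq_image)

lemma components_nonempty: "C \<in> components G \<Longrightarrow> C \<noteq> {}"
  unfolding components_eq_image using in_component_of_self by blast

lemma components_subset_verts: "C \<in> components G \<Longrightarrow> C \<subseteq> verts G"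
  using wf_digraph.sccs_verts_subsets[OF wf_mk_symmetric] by simp

lemma Union_components: "\<Union>(components G) = verts G"
proof
  show "\<Union>(components G) \<subseteq> verts G"
    using components_subset_verts by blast
  show "verts G \<subseteq> \<Union>(components G)"
    using component_of_in_components in_component_of_self by blast
qed

lemma disjoint_components: "pairwise disjnt (components G)"
  using wf_digraph.sccs_verts_disjoint[OF wf_mk_symmetric] by (auto simp: pairwise_def disjnt_def)

lemma component_of_eq:
  assumes "C \<in> components G" "u \<in> C"
  shows "component_of G u = C"
proof (rule ccontr)
  have "u \<in> verts G" using assms components_subset_verts by blast
  then have u: "u \<in> component_of G u" "component_of G u \<in> components G"
    by (rule in_component_of_self, rule component_of_in_components)
  assume "component_of G u \<noteq> C"
  then have "disjnt (component_of G u) C"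
    using disjoint_components u(2) assms(1) by (simp add: pairwise_def)
  then show False using u(1) assms(2) by (auto simp: disjnt_def)
qed

lemma reachable_imp_eq:
  assumes "u \<rightarrow>\<^sup>*\<^bsub>with_proj (mk_symmetric G)\<^esub> v" and "\<And>\<epsilon>. \<epsilon> \<in> arcs G \<Longrightarrow> f (tail G \<epsilon>) = f (head G \<epsilon>)"
  shows "f u = f v"
  using assms(1)
proof (induction rule: wf_digraph.reachable_induct[OF wf_mk_symmetric, consumes 1])
  case (2 x y)
  then show ?case using assms(2) by (auto simp: parcs_mk_symmetric arcs_ends_def arc_to_ends_def)
qed simp

lemma component_imp_eq:
  assumes "C \<in> components G" "u \<in> C" "v \<in> C"
    and "\<And>\<epsilon>. \<epsilon> \<in> arcs G \<Longrightarrow> f (tail G \<epsilon>) = f (head G \<epsilon>)"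
  shows "f u = f v"
proof (rule reachable_imp_eq)
  show "u \<rightarrow>\<^sup>*\<^bsub>with_proj (mk_symmetric G)\<^esub> v"
    using assms(1-3) by (auto simp: pre_digraph.sccs_verts_def)
qed (rule assms(4))

lemma component_of_tail_eq_head:
  assumes "\<epsilon> \<in> arcs G"
  shows "component_of G (tail G \<epsilon>) = component_of G (head G \<epsilon>)"
proof -
  have "(tail G \<epsilon>, head G \<epsilon>) \<in> parcs (mk_symmetric G)" "(head G \<epsilon>, tail G \<epsilon>) \<in> parcs (mk_symmetric G)"
    using assms by (auto simp: parcs_mk_symmetric)
  then have "tail G \<epsilon> \<in> component_of G (head G \<epsilon>)"
    using wf_digraph.adj_in_verts[OF wf_mk_symmetric] wf_digraph.reachable_adjI[OF wf_mk_symmetric]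
    by (auto simp: pre_digraph.scc_of_def)
  then show ?thesis by (rule wf_digraph.scc_of_eq[OF wf_mk_symmetric])
qed

lemma components_connected:
  assumes "connected G"
  shows "components G = {verts G}"
proof -
  have "verts G \<noteq> {}" "\<And>u v. u \<in> verts G \<Longrightarrow> v \<in> verts G \<Longrightarrow> v \<in> component_of G u"
    using assms by (auto simp: connected_def strongly_connected_def pre_digraph.scc_of_def)
  moreover have "component_of G u \<subseteq> verts G" if "u \<in> verts G" for u
    using components_subset_verts component_of_in_components that by blast
  ultimately have "component_of G u = verts G" if "u \<in> verts G" for u
    using that by blast
  then show ?thesis using \<open>verts G \<noteq> {}\<close> by (auto simp: components_eq_image)
qed

end

section \<open>Linear extensions\<close>

text \<open>
  The linear extensions correspond to the bijections \<open>f\<close> from the \<open>n\<close> vertices onto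
  \<open>{0,\<dots>,n - 1}\<close> that increase along the edges. Since heads precede tails in
  \<^const>\<open>edge_order\<close>, the linear order attached to \<open>f\<close> ranks the vertices by decreasing \<open>f\<close>. The inverse sends a linear order to the
  function counting the vertices strictly above a given one.
\<close>

lemma bij_betw_linear_extensions:
  fixes K :: "('v, 'e) pre_digraph"
  assumes "fin_digraph K" and noloop: "\<And>\<epsilon>. \<epsilon> \<in> arcs K \<Longrightarrow> tail K \<epsilon> \<noteq> head K \<epsilon>"
  shows "bij_betw (\<lambda>f. {(x, y) \<in> verts K \<times> verts K. f y \<le> f x})
    {f. f \<in> verts K \<rightarrow>\<^sub>E {..<card (verts K)} \<and> f ` verts K = {..<card (verts K)} \<and>
        (\<forall>\<epsilon>\<in>arcs K. f (tail K \<epsilon>) < f (head K \<epsilon>))}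
    (linear_extensions K)" (is "bij_betw ?r ?S ?L")
proof -
  interpret fin_digraph K by fact
  let ?V = "verts K" and ?n = "card (verts K)"
  define g where "g r x = card {z \<in> ?V. (x, z) \<in> r \<and> z \<noteq> x}" for r :: "'v rel" and x
  let ?g = "\<lambda>r. restrict (g r) ?V"
  have S: "f \<in> ?V \<rightarrow>\<^sub>E {..<?n}" "f ` ?V = {..<?n}" "inj_on f ?V"
    "\<And>\<epsilon>. \<epsilon> \<in> arcs K \<Longrightarrow> f (tail K \<epsilon>) < f (head K \<epsilon>)" if "f \<in> ?S" for f
  proof -
    show *: "f ` ?V = {..<?n}" using that by blast
    show "inj_on f ?V" by (rule eq_card_imp_inj_on) (simp_all add: *)
  qed (use that in blast)+
  have g_less: "g r y < g r x"
    if r: "linear_order_on ?V r" and xy: "(x, y) \<in> r" "x \<noteq> y" "x \<in> ?V" "y \<in> ?V" for r x y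
  proof -
    have "antisym r" "trans r" using r by (auto simp: order_on_defs)
    then have "{z \<in> ?V. (y, z) \<in> r \<and> z \<noteq> y} \<subset> {z \<in> ?V. (x, z) \<in> r \<and> z \<noteq> x}"
      using xy by (auto dest: antisymD transD)
    then show ?thesis
      unfolding g_def by (intro psubset_card_mono) auto
  qed
  have g_le: "g r y \<le> g r x \<longleftrightarrow> (x, y) \<in> r"
    if r: "linear_order_on ?V r" and xy: "x \<in> ?V" "y \<in> ?V" for r x y
  proof (cases "x = y")
    case True
    then show ?thesis using r xy by (auto simp: order_on_defs refl_on_def)
  next
    case False
    have anti: "antisym r" using r by (auto simp: order_on_defs)
    from False have "(x, y) \<in> r \<or> (y, x) \<in> r"
      using r xy by (auto simp: order_on_defs total_on_def)
    then show ?thesis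
    proof
      assume "(x, y) \<in> r"
      then show ?thesis using g_less[OF r, of x y] False xy by simp
    next
      assume yx: "(y, x) \<in> r"
      then have "(x, y) \<notin> r" using False antisymD[OF anti] by blast
      then show ?thesis using g_less[OF r yx] False xy by simp
    qed
  qed
  have g_im: "g r ` ?V = {..<?n}" if r: "linear_order_on ?V r" for r
  proof (rule card_subset_eq)
    have "g r x < ?n" if "x \<in> ?V" for x
      unfolding g_def by (rule psubset_card_mono) (use that in auto)
    then show "g r ` ?V \<subseteq> {..<?n}" by blast
    have "inj_on (g r) ?V"
    proof (rule inj_onI)
      fix x y assume "x \<in> ?V" "y \<in> ?V" "g r x = g r y"
      then have "(x, y) \<in> r" "(y, x) \<in> r" using g_le[OF r, of x y] g_le[OF r, of y x] by simp_all
      moreover have "antisym r" using r by (auto simp: order_on_defs)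
      ultimately show "x = y" by (rule antisymD[rotated 1])
    qed
    then show "card (g r ` ?V) = card {..<?n}" by (simp add: card_image)
  qed simp
  show ?thesis
  proof (rule bij_betw_byWitness[where f' = ?g])
    show "\<forall>f\<in>?S. ?g (?r f) = f"
    proof
      fix f assume "f \<in> ?S"
      note f = S[OF this]
      have "g (?r f) x = f x" if x: "x \<in> ?V" for x
      proof -
        have "{z \<in> ?V. (x, z) \<in> ?r f \<and> z \<noteq> x} = {z \<in> ?V. f z < f x}"
          using x inj_onD[OF f(3), of _ x] by (auto simp: order_less_le)
        moreover have "f ` {z \<in> ?V. f z < f x} = {..<f x}"
        proof -
          have "f x < ?n" using f(2) x by blast
          have "k \<in> f ` {z \<in> ?V. f z < f x}" if "k < f x" for k
          proof -
            have "k \<in> f ` ?V" using f(2) \<open>f x < ?n\<close> that by simp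
            then show ?thesis using that by auto
          qed
          then show ?thesis by auto
        qed
        moreover have "inj_on f {z \<in> ?V. f z < f x}"
          by (rule inj_on_subset[OF f(3)]) auto
        ultimately show ?thesis unfolding g_def by (metis card_image card_lessThan)
      qed
      moreover have "f x = undefined" if "x \<notin> ?V" for x
        using f(1) that by (rule PiE_arb)
      ultimately show "?g (?r f) = f" unfolding fun_eq_iff restrict_def by simp
    qed
    show "\<forall>r\<in>?L. ?r (?g r) = r"
    proof
      fix r assume "r \<in> ?L"
      then have r: "linear_order_on ?V r" by (simp add: linear_extensions_def)
      then have "r \<subseteq> ?V \<times> ?V" by (simp add: order_on_defs)
      moreover have "?r (?g r) = {(x, y) \<in> ?V \<times> ?V. (x, y) \<in> r}"
        using g_le[OF r] by auto
      ultimately show "?r (?g r) = r" by blast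
    qed
    show "?r ` ?S \<subseteq> ?L"
    proof (rule image_subsetI)
      fix f assume "f \<in> ?S"
      note f = S[OF this]
      have mono: "f u \<le> f v" if "u \<rightarrow>\<^sup>*\<^bsub>K\<^esub> v" for u v
        using that
      proof (induction rule: reachable_induct)
        case (step x y)
        then obtain \<epsilon> where "\<epsilon> \<in> arcs K" "x = tail K \<epsilon>" "y = head K \<epsilon>"
          by (auto simp: arcs_ends_def arc_to_ends_def)
        then show ?case using f(4)[of \<epsilon>] step.IH by simp
      qed simp
      have "linear_order_on ?V (?r f)"
        using inj_onD[OF f(3)]
        unfolding order_on_defs refl_on_def trans_def antisym_def total_on_def by auto
      moreover have "edge_order K \<subseteq> ?r f"
        using mono by (auto simp: edge_order_def reachable_in_verts)
      ultimately show "?r f \<in> ?L" by (simp add: linear_extensions_def)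
    qed
    show "?g ` ?L \<subseteq> ?S"
    proof (rule image_subsetI)
      fix r assume rL: "r \<in> ?L"
      then have r: "linear_order_on ?V r" by (simp add: linear_extensions_def)
      have "g r (tail K \<epsilon>) < g r (head K \<epsilon>)" if \<epsilon>: "\<epsilon> \<in> arcs K" for \<epsilon>
      proof -
        have "tail K \<epsilon> \<rightarrow>\<^sup>*\<^bsub>K\<^esub> head K \<epsilon>"
          using \<epsilon> by (intro reachable_adjI) (rule in_arcs_imp_in_arcs_ends)
        then have "(head K \<epsilon>, tail K \<epsilon>) \<in> edge_order K" by (simp add: edge_order_def)
        then have "(head K \<epsilon>, tail K \<epsilon>) \<in> r" using rL by (auto simp: linear_extensions_def)
        then show ?thesis using noloop[OF \<epsilon>] \<epsilon> by (intro g_less[OF r]) auto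
      qed
      then have "\<forall>\<epsilon>\<in>arcs K. ?g r (tail K \<epsilon>) < ?g r (head K \<epsilon>)" by simp
      moreover have "?g r ` ?V = {..<?n}" using g_im[OF r] by simp
      moreover have "?g r \<in> ?V \<rightarrow>\<^sub>E {..<?n}" using g_im[OF r] by auto
      ultimately show "?g r \<in> ?S" by blast
    qed
  qed
qed

lemma (in wf_digraph) awalk_strict_mono:
  fixes f :: "'a \<Rightarrow> nat"
  assumes f: "\<And>\<epsilon>. \<epsilon> \<in> arcs G \<Longrightarrow> f (tail G \<epsilon>) < f (head G \<epsilon>)"
  shows "awalk u p v \<Longrightarrow> p \<noteq> [] \<Longrightarrow> f u < f v"
proof (induction p arbitrary: u)
  case (Cons \<epsilon> p)
  then have \<epsilon>: "\<epsilon> \<in> arcs G" "u = tail G \<epsilon>" "awalk (head G \<epsilon>) p v"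
    by (auto simp: awalk_Cons_iff)
  show ?case
  proof (cases "p = []")
    case True
    then have "v = head G \<epsilon>" using \<epsilon>(3) by (simp add: awalk_Nil_iff)
    then show ?thesis using f[OF \<epsilon>(1)] \<epsilon>(2) by simp
  next
    case False
    then show ?thesis using Cons.IH[OF \<epsilon>(3)] f[OF \<epsilon>(1)] \<epsilon>(2) by simp
  qed
qed simp

text \<open>
  For a quiver with a directed cycle no function increases along all edges, which agrees with the
  value 0 of \<^const>\<open>e0\<close>.
\<close>

lemma e0_eq_card:
  assumes "fin_digraph K" and noloop: "\<And>\<epsilon>. \<epsilon> \<in> arcs K \<Longrightarrow> tail K \<epsilon> \<noteq> head K \<epsilon>"
  shows "e0 K = of_nat (card {f. f \<in> verts K \<rightarrow>\<^sub>E {..<card (verts K)} \<and>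
        f ` verts K = {..<card (verts K)} \<and> (\<forall>\<epsilon>\<in>arcs K. f (tail K \<epsilon>) < f (head K \<epsilon>))}) /
     (fact (card (verts K)) :: 'k::field_char_0)"
proof (cases "acyclic_quiver K")
  case True
  then show ?thesis
    using bij_betw_same_card[OF bij_betw_linear_extensions[OF assms]] by (simp add: e0_def)
next
  case False
  interpret fin_digraph K by fact
  obtain u p where p: "awalk u p u" "p \<noteq> []"
    using False by (auto simp: acyclic_quiver_def cycle_def)
  have "\<not> (\<forall>\<epsilon>\<in>arcs K. f (tail K \<epsilon>) < f (head K \<epsilon>))" for f :: "_ \<Rightarrow> nat"
    using awalk_strict_mono[of f, OF _ p] by blast
  then have "{f. f \<in> verts K \<rightarrow>\<^sub>E {..<card (verts K)} \<and>
        f ` verts K = {..<card (verts K)} \<and> (\<forall>\<epsilon>\<in>arcs K. f (tail K \<epsilon>) < f (head K \<epsilon>))} = {}"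
    by blast
  then show ?thesis using False by (simp only: e0_def if_False card.empty) simp
qed

section \<open>Order polynomials of quivers and the function \<open>\<omega>\<close>\<close>

text \<open>
  The summands of \<open>P\<^sub>G\<close> and of \<open>Q\<^sub>G\<close>, with an arbitrary family \<open>b\<close> in place of \<open>\<beta>\<^sub>\<epsilon>\<^sub>,\<^sub>-\<close>.
\<close>

definition cut_weight :: "('e \<Rightarrow> 'k::field_char_0) \<Rightarrow> ('v, 'e) pre_digraph \<Rightarrow> ('v \<Rightarrow> nat) \<Rightarrow> 'k" where
  "cut_weight b G f = (\<Prod>\<epsilon>\<in>arcs G. b \<epsilon> + of_bool (f (tail G \<epsilon>) < f (head G \<epsilon>)))"

definition contr_weight :: "('e \<Rightarrow> 'k::field_char_0) \<Rightarrow> ('v, 'e) pre_digraph \<Rightarrow> ('v \<Rightarrow> nat) \<Rightarrow> 'k" where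
  "contr_weight b G f = (\<Prod>\<epsilon>\<in>arcs G. of_bool (f (tail G \<epsilon>) < f (head G \<epsilon>))
     - b \<epsilon> * of_bool (f (tail G \<epsilon>) = f (head G \<epsilon>)))"

lemma (in wf_digraph) order_invariant_cut_weight: "order_invariant (verts G) (cut_weight b G)"
  unfolding order_invariant_def cut_weight_def by (intro allI impI prod.cong refl) simp

lemma (in wf_digraph) order_invariant_contr_weight: "order_invariant (verts G) (contr_weight b G)"
proof -
  have eq: "x = y \<longleftrightarrow> \<not> x < y \<and> \<not> y < x" for x y :: nat by auto
  show ?thesis
    unfolding order_invariant_def contr_weight_def eq by (intro allI impI prod.cong refl) simp
qed

lemma prod_of_bool: "finite A \<Longrightarrow> (\<Prod>x\<in>A. of_bool (P x)) = (of_bool (\<forall>x\<in>A. P x) :: 'k::comm_semiring_1)"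
  by (induction A rule: finite_induct) auto

text \<open>
  The top coefficient of \<open>Q\<^sub>K\<close> is the sum of the weights over all bijections from the \<open>n\<close> vertices onto
  \<open>{0,\<dots>,n - 1}\<close>, divided by \<open>n!\<close>. For a bijection, the term \<open>- b\<^sub>\<epsilon>\<close> survives exactly at the tadpoles,
  and the other edges contribute the indicator of being a linear extension of the pruned quiver.
\<close>

lemma coeff_contr_poly_top:
  fixes \<beta> :: "'e \<Rightarrow> 'k::field_char_0"
  assumes "fin_digraph K"
  shows "coeff (count_poly (verts K) (contr_weight (\<lambda>\<epsilon>. beta_sgn \<beta> \<epsilon> (- 1)) K)) (card (verts K)) =
    e_quiver \<beta> K"
proof -
  interpret fin_digraph K by fact
  let ?b = "\<lambda>\<epsilon>. beta_sgn \<beta> \<epsilon> (- 1)" and ?V = "verts K" and ?n = "card (verts K)" and ?P = "prune K"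
  define S where "S = {f. f \<in> ?V \<rightarrow>\<^sub>E {..<?n} \<and> f ` ?V = {..<?n}}"
  have pr: "arcs ?P = arcs K - tadpoles K" "verts ?P = ?V" "tail ?P = tail K" "head ?P = head K"
    by (simp_all add: prune_def)
  have "finite (?V \<rightarrow>\<^sub>E {..<?n})" by (intro finite_PiE) auto
  then have finS: "finite S" by (rule rev_finite_subset) (auto simp: S_def)
  have "fin_digraph ?P" by unfold_locales (auto simp: pr)
  then have e0: "e0 ?P = of_nat (card {f \<in> S. \<forall>\<epsilon>\<in>arcs ?P. f (tail K \<epsilon>) < f (head K \<epsilon>)}) / (fact ?n :: 'k)"
    by (subst e0_eq_card) (auto simp: pr tadpoles_def S_def conj_assoc)
  have weight: "contr_weight ?b K f =
      (\<Prod>\<epsilon>\<in>tadpoles K. - ?b \<epsilon>) * of_bool (\<forall>\<epsilon>\<in>arcs ?P. f (tail K \<epsilon>) < f (head K \<epsilon>))"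
    if "f \<in> S" for f
  proof -
    have im: "f ` ?V = {..<?n}" using that by (simp add: S_def)
    have inj: "inj_on f ?V" by (rule eq_card_imp_inj_on) (simp_all add: im)
    have sub: "tadpoles K \<subseteq> arcs K" by (auto simp: tadpoles_def)
    have "contr_weight ?b K f =
        (\<Prod>\<epsilon>\<in>tadpoles K. of_bool (f (tail K \<epsilon>) < f (head K \<epsilon>)) - ?b \<epsilon> * of_bool (f (tail K \<epsilon>) = f (head K \<epsilon>))) *
        (\<Prod>\<epsilon>\<in>arcs ?P. of_bool (f (tail K \<epsilon>) < f (head K \<epsilon>)) - ?b \<epsilon> * of_bool (f (tail K \<epsilon>) = f (head K \<epsilon>)))"
      unfolding contr_weight_def pr by (subst prod.subset_diff[OF sub]) (simp_all add: mult.commute)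
    also have "(\<Prod>\<epsilon>\<in>tadpoles K. of_bool (f (tail K \<epsilon>) < f (head K \<epsilon>)) - ?b \<epsilon> * of_bool (f (tail K \<epsilon>) = f (head K \<epsilon>))) =
        (\<Prod>\<epsilon>\<in>tadpoles K. - ?b \<epsilon>)"
      by (rule prod.cong) (auto simp: tadpoles_def)
    also have "(\<Prod>\<epsilon>\<in>arcs ?P. of_bool (f (tail K \<epsilon>) < f (head K \<epsilon>)) - ?b \<epsilon> * of_bool (f (tail K \<epsilon>) = f (head K \<epsilon>))) =
        (\<Prod>\<epsilon>\<in>arcs ?P. of_bool (f (tail K \<epsilon>) < f (head K \<epsilon>)))"
    proof (rule prod.cong[OF refl])
      fix \<epsilon> assume "\<epsilon> \<in> arcs ?P"
      then have "tail K \<epsilon> \<in> ?V" "head K \<epsilon> \<in> ?V" "tail K \<epsilon> \<noteq> head K \<epsilon>"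
        by (auto simp: pr tadpoles_def)
      then have "f (tail K \<epsilon>) \<noteq> f (head K \<epsilon>)" using inj_onD[OF inj] by blast
      then show "of_bool (f (tail K \<epsilon>) < f (head K \<epsilon>)) - ?b \<epsilon> * of_bool (f (tail K \<epsilon>) = f (head K \<epsilon>)) =
          (of_bool (f (tail K \<epsilon>) < f (head K \<epsilon>)) :: 'k)" by simp
    qed
    also have "\<dots> = of_bool (\<forall>\<epsilon>\<in>arcs ?P. f (tail K \<epsilon>) < f (head K \<epsilon>))"
      by (rule prod_of_bool) (simp add: pr)
    finally show ?thesis .
  qed
  have "surj_sum ?V (contr_weight ?b K) ?n =
      (\<Sum>f\<in>S. (\<Prod>\<epsilon>\<in>tadpoles K. - ?b \<epsilon>) * of_bool (\<forall>\<epsilon>\<in>arcs ?P. f (tail K \<epsilon>) < f (head K \<epsilon>)))"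
    unfolding surj_sum_def S_def[symmetric] by (rule sum.cong[OF refl weight])
  also have "\<dots> = (\<Prod>\<epsilon>\<in>tadpoles K. - ?b \<epsilon>) *
      of_nat (card {f \<in> S. \<forall>\<epsilon>\<in>arcs ?P. f (tail K \<epsilon>) < f (head K \<epsilon>)})"
    using finS by (simp add: sum_distrib_left[symmetric] Int_def)
  finally show ?thesis
    by (simp add: coeff_count_poly_card e_quiver_def e0)
qed

text \<open>
  \<open>P\<^sub>G\<close> is the product of the polynomials of the components, each of which vanishes at 0 because
  there is no map from a nonempty set to the empty set.
\<close>

lemma coeff_cut_poly_low:
  fixes b :: "'e \<Rightarrow> 'k::field_char_0"
  assumes "fin_digraph G" "c < card (components G)"
  shows "coeff (count_poly (verts G) (cut_weight b G)) c = 0"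
proof -
  interpret fin_digraph G by fact
  let ?K = "components G"
  define E where "E C = {\<epsilon> \<in> arcs G. component_of G (tail G \<epsilon>) = C}" for C
  define w where "w C f = (\<Prod>\<epsilon>\<in>E C. b \<epsilon> + of_bool (f (tail G \<epsilon>) < f (head G \<epsilon>)))" for C and f :: "'a \<Rightarrow> nat"
  have finK: "finite ?K" by (rule finite_components) fact
  have E: "tail G \<epsilon> \<in> C" "head G \<epsilon> \<in> C" if "\<epsilon> \<in> E C" for \<epsilon> C
    using that in_component_of_self component_of_tail_eq_head[of \<epsilon>] by (auto simp: E_def)
  have inv: "order_invariant C (w C)" for C
    unfolding order_invariant_def w_def using E by (intro allI impI prod.cong refl) simp
  have finC: "finite C" if "C \<in> ?K" for C
    using components_subset_verts[OF that] finite_verts by (rule finite_subset)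
  have cut: "cut_weight b G f = (\<Prod>C\<in>?K. w C f)" for f
    unfolding cut_weight_def w_def E_def
    by (rule prod.group[symmetric]) (auto simp: finK component_of_in_components)
  have "count_poly (verts G) (cut_weight b G) = (\<Prod>C\<in>?K. count_poly C (w C))"
  proof (rule poly_eqI_of_nat)
    fix N
    have "poly (count_poly (verts G) (cut_weight b G)) (of_nat N) =
        (\<Sum>f\<in>\<Union>?K \<rightarrow>\<^sub>E {..<N}. \<Prod>C\<in>?K. w C f)"
      by (simp add: poly_count_poly order_invariant_cut_weight cut Union_components)
    also have "\<dots> = (\<Prod>C\<in>?K. \<Sum>f\<in>C \<rightarrow>\<^sub>E {..<N}. w C f)"
    proof (rule sum_PiE_Union_disjoint[OF finK disjoint_components])
      fix C and f g :: "'a \<Rightarrow> nat"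
      assume "\<And>x. x \<in> C \<Longrightarrow> f x = g x"
      then show "w C f = w C g" by (intro order_invariantD[OF inv]) simp
    qed
    also have "\<dots> = poly (\<Prod>C\<in>?K. count_poly C (w C)) (of_nat N)"
      unfolding poly_prod by (rule prod.cong) (simp_all add: poly_count_poly inv finC)
    finally show "poly (count_poly (verts G) (cut_weight b G)) (of_nat N) =
        poly (\<Prod>C\<in>?K. count_poly C (w C)) (of_nat N)" .
  qed
  moreover have "(\<Prod>C\<in>?K. [:0, 1:]) dvd (\<Prod>C\<in>?K. count_poly C (w C))"
  proof (rule prod_dvd_prod)
    fix C assume C: "C \<in> ?K"
    then have "C \<rightarrow>\<^sub>E {..<0::nat} = {}" using components_nonempty[OF C] by (auto simp: PiE_eq_empty_iff)
    then have "poly (count_poly C (w C)) (of_nat 0) = 0"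
      by (subst poly_count_poly[OF finC[OF C] inv]) simp
    then show "[:0, 1:] dvd count_poly C (w C)"
      using poly_eq_0_iff_dvd[of "count_poly C (w C)" 0] by simp
  qed
  ultimately have "monom 1 (card ?K) dvd count_poly (verts G) (cut_weight b G)"
    by (simp add: monom_altdef)
  then show ?thesis using assms(2) by (simp add: monom_1_dvd_iff')
qed

text \<open>
  Comparison of the coefficients of \<open>M\<^sup>c N\<^sup>c\<close> in an identity between polynomials in \<open>M\<close> and \<open>N\<close>,
  carried out first in \<open>N\<close> for every number \<open>M\<close> and then in \<open>M\<close>.
\<close>

lemma sum_coeff_mult_eq:
  fixes p q :: "'i \<Rightarrow> 'k::field_char_0 poly"
  assumes "finite I"
    and eq: "\<And>M N. (\<Sum>i\<in>I. poly (q i) (of_nat M) * poly (p i) (of_nat N)) = poly s (of_nat M * of_nat N)"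
  shows "(\<Sum>i\<in>I. coeff (q i) c * coeff (p i) c) = coeff s c"
proof -
  have "(\<Sum>i\<in>I. smult (coeff (p i) c) (q i)) = monom (coeff s c) c"
  proof (rule poly_eqI_of_nat)
    fix M
    have "(\<Sum>i\<in>I. smult (poly (q i) (of_nat M)) (p i)) = pcompose s [:0, of_nat M:]"
      by (rule poly_eqI_of_nat) (simp add: poly_sum poly_pcompose eq mult.commute[of _ "of_nat M"])
    then have "coeff (\<Sum>i\<in>I. smult (poly (q i) (of_nat M)) (p i)) c = coeff (pcompose s [:0, of_nat M:]) c"
      by simp
    then show "poly (\<Sum>i\<in>I. smult (coeff (p i) c) (q i)) (of_nat M) = poly (monom (coeff s c) c) (of_nat M)"
      by (simp add: coeff_sum coeff_pcompose_linear poly_sum poly_monom mult.commute)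
  qed
  then have "coeff (\<Sum>i\<in>I. smult (coeff (p i) c) (q i)) c = coeff s c" by simp
  then show ?thesis by (simp add: coeff_sum mult.commute)
qed

lemma (in wf_digraph) spanning_iff: "spanning H G \<longleftrightarrow> (\<exists>F\<subseteq>arcs G. H = G\<lparr>arcs := F\<rparr>)"
proof
  assume H: "spanning H G"
  then show "\<exists>F\<subseteq>arcs G. H = G\<lparr>arcs := F\<rparr>"
    using spanning_eq_update[OF H] by (auto simp: spanning_def subgraph_def)
next
  assume "\<exists>F\<subseteq>arcs G. H = G\<lparr>arcs := F\<rparr>"
  then obtain F where F: "F \<subseteq> arcs G" "H = G\<lparr>arcs := F\<rparr>" by blast
  have "wf_digraph H" using F by unfold_locales auto
  then show "spanning H G"
    using F wf_digraph_axioms by (auto simp: spanning_def subgraph_def compatible_def)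
qed

lemma (in wf_digraph) sum_spanning:
  "(\<Sum>H | spanning H G. \<phi> H) = (\<Sum>F\<in>Pow (arcs G). \<phi> (G\<lparr>arcs := F\<rparr>))"
proof (rule sum.reindex_bij_witness[where i = "\<lambda>F. G\<lparr>arcs := F\<rparr>" and j = arcs])
  fix H assume "H \<in> {H. spanning H G}"
  then have H: "spanning H G" by simp
  show "G\<lparr>arcs := arcs H\<rparr> = H" using spanning_eq_update[OF H] by simp
  then show "\<phi> (G\<lparr>arcs := arcs H\<rparr>) = \<phi> H" by simp
  show "arcs H \<in> Pow (arcs G)" using H by (auto simp: spanning_def subgraph_def)
qed (use spanning_iff in auto)

text \<open>
  The maps on the vertices of \<open>G/H\<close> are the maps on the vertices of \<open>G\<close> that are constant along the
  edges of \<open>H\<close>.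
\<close>

lemma sum_contr_weight_contract:
  fixes b :: "'e \<Rightarrow> 'k::field_char_0" and G :: "('v, 'e) pre_digraph"
  assumes "fin_digraph G" and F: "F \<subseteq> arcs G" and T: "finite T"
  defines "H \<equiv> G\<lparr>arcs := F\<rparr>"
  shows "(\<Sum>g\<in>components H \<rightarrow>\<^sub>E T. contr_weight b (contract_quiver G H) g) =
    (\<Sum>f\<in>verts G \<rightarrow>\<^sub>E T. (\<Prod>\<epsilon>\<in>F. of_bool (f (tail G \<epsilon>) = f (head G \<epsilon>))) *
       (\<Prod>\<epsilon>\<in>arcs G - F. of_bool (f (tail G \<epsilon>) < f (head G \<epsilon>))
          - b \<epsilon> * of_bool (f (tail G \<epsilon>) = f (head G \<epsilon>))))"
proof -
  interpret fin_digraph G by fact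
  have "spanning H G" unfolding spanning_iff H_def using F by blast
  then have finH: "fin_digraph H" by (rule spanning_fin_digraph[OF assms(1)])
  interpret H: fin_digraph H by (rule finH)
  have [simp]: "verts H = verts G" "arcs H = F" "tail H = tail G" "head H = head G" by (simp_all add: H_def)
  have finT: "finite F" using F finite_arcs by (rule finite_subset)
  let ?K = "contract_quiver G H" and ?V = "verts G"
  let ?w = "\<lambda>f. \<Prod>\<epsilon>\<in>arcs G - F. of_bool (f (tail G \<epsilon>) < f (head G \<epsilon>))
          - b \<epsilon> * of_bool (f (tail G \<epsilon>) = f (head G \<epsilon>))"
  let ?S = "{f \<in> ?V \<rightarrow>\<^sub>E T. \<forall>\<epsilon>\<in>F. f (tail G \<epsilon>) = f (head G \<epsilon>)}"
  define lift where "lift g = (\<lambda>v\<in>?V. g (component_of H v))" for g :: "'v set \<Rightarrow> nat"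
  define drop where "drop f = (\<lambda>C\<in>components H. f (SOME v. v \<in> C))" for f :: "'v \<Rightarrow> nat"
  have some: "(SOME v. v \<in> C) \<in> C" if "C \<in> components H" for C
    using H.components_nonempty[OF that] by (simp add: some_in_eq)
  have "(\<Sum>g\<in>components H \<rightarrow>\<^sub>E T. contr_weight b ?K g) = (\<Sum>f\<in>?S. ?w f)"
  proof (rule sum.reindex_bij_witness[where i = drop and j = lift])
    fix g assume g: "g \<in> components H \<rightarrow>\<^sub>E T"
    have "drop (lift g) C = g C" for C
    proof (cases "C \<in> components H")
      case True
      then have "(SOME v. v \<in> C) \<in> ?V" using some H.components_subset_verts by fastforce
      then show ?thesis using True some[OF True] by (simp add: drop_def lift_def H.component_of_eq)
    next
      case False
      then show ?thesis using PiE_arb[OF g] by (simp add: drop_def)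
    qed
    then show "drop (lift g) = g" by blast
    have "g (component_of H v) \<in> T" if "v \<in> ?V" for v
      using g H.component_of_in_components that by auto
    then show "lift g \<in> ?S"
      using F H.component_of_tail_eq_head by (auto simp: lift_def)
    show "?w (lift g) = contr_weight b ?K g"
      unfolding contr_weight_def by (rule prod.cong) (auto simp: contract_quiver_def lift_def)
  next
    fix f assume f: "f \<in> ?S"
    have const: "f u = f v" if "C \<in> components H" "u \<in> C" "v \<in> C" for C u v
      using that by (rule H.component_imp_eq) (use f in auto)
    have "lift (drop f) v = f v" for v
    proof (cases "v \<in> ?V")
      case True
      then have C: "component_of H v \<in> components H" "v \<in> component_of H v"
        using H.component_of_in_components H.in_component_of_self by auto
      then show ?thesis using True const[OF C(1) some[OF C(1)] C(2)] by (simp add: drop_def lift_def)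
    next
      case False
      then show ?thesis using f by (auto simp: lift_def)
    qed
    then show "lift (drop f) = f" by blast
    have "(SOME v. v \<in> C) \<in> ?V" if "C \<in> components H" for C
      using some[OF that] H.components_subset_verts[OF that] by auto
    then show "drop f \<in> components H \<rightarrow>\<^sub>E T"
      using f by (auto simp: drop_def)
  qed
  also have "\<dots> = (\<Sum>f\<in>?V \<rightarrow>\<^sub>E T. of_bool (\<forall>\<epsilon>\<in>F. f (tail G \<epsilon>) = f (head G \<epsilon>)) * ?w f)"
    using finite_PiE[of ?V "\<lambda>_. T"] T by (intro sum.mono_neutral_cong_left) auto
  finally show ?thesis by (simp add: prod_of_bool finT)
qed


text \<open>
  This is the identity \<open>\<Sum>H. Q\<^bsub>G/H\<^esub>(M) P\<^sub>H(N) = S\<^sub>G(M N)\<close>.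
\<close>

lemma sum_contr_times_cut:
  fixes b :: "'e \<Rightarrow> 'k::field_char_0" and G :: "('v, 'e) pre_digraph"
  assumes "fin_digraph G"
  shows "(\<Sum>H | spanning H G. (\<Sum>g\<in>components H \<rightarrow>\<^sub>E {..<M}. contr_weight b (contract_quiver G H) g) *
      (\<Sum>f\<in>verts G \<rightarrow>\<^sub>E {..<N}. cut_weight b H f)) =
    (\<Sum>f\<in>verts G \<rightarrow>\<^sub>E {..<M * N}. cut_weight (\<lambda>_. 0) G f)"
proof -
  interpret fin_digraph G by fact
  let ?V = "verts G" and ?A = "arcs G"
  let ?lt = "\<lambda>f \<epsilon>. of_bool (f (tail G \<epsilon>) < (f (head G \<epsilon>) :: nat)) :: 'k"
    and ?eq = "\<lambda>f \<epsilon>. of_bool (f (tail G \<epsilon>) = (f (head G \<epsilon>) :: nat)) :: 'k"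
  let ?lex = "\<lambda>f g \<epsilon>. of_bool (f (tail G \<epsilon>) < (f (head G \<epsilon>) :: nat) \<or>
      f (tail G \<epsilon>) = f (head G \<epsilon>) \<and> g (tail G \<epsilon>) < (g (head G \<epsilon>) :: nat)) :: 'k"
  have "(\<Sum>H | spanning H G. (\<Sum>g\<in>components H \<rightarrow>\<^sub>E {..<M}. contr_weight b (contract_quiver G H) g) *
      (\<Sum>f\<in>?V \<rightarrow>\<^sub>E {..<N}. cut_weight b H f)) =
    (\<Sum>F\<in>Pow ?A. (\<Sum>f\<in>?V \<rightarrow>\<^sub>E {..<M}. (\<Prod>\<epsilon>\<in>F. ?eq f \<epsilon>) * (\<Prod>\<epsilon>\<in>?A - F. ?lt f \<epsilon> - b \<epsilon> * ?eq f \<epsilon>)) *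
      (\<Sum>g\<in>?V \<rightarrow>\<^sub>E {..<N}. \<Prod>\<epsilon>\<in>F. b \<epsilon> + ?lt g \<epsilon>))"
    unfolding sum_spanning
    by (intro sum.cong refl arg_cong2[where f = times] sum_contr_weight_contract[OF assms])
      (auto simp: cut_weight_def)
  also have "\<dots> = (\<Sum>F\<in>Pow ?A. \<Sum>f\<in>?V \<rightarrow>\<^sub>E {..<M}. \<Sum>g\<in>?V \<rightarrow>\<^sub>E {..<N}.
      (\<Prod>\<epsilon>\<in>F. ?eq f \<epsilon> * (b \<epsilon> + ?lt g \<epsilon>)) * (\<Prod>\<epsilon>\<in>?A - F. ?lt f \<epsilon> - b \<epsilon> * ?eq f \<epsilon>))"
    unfolding sum_product by (intro sum.cong refl) (simp only: prod.distrib mult_ac)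
  also have "\<dots> = (\<Sum>f\<in>?V \<rightarrow>\<^sub>E {..<M}. \<Sum>g\<in>?V \<rightarrow>\<^sub>E {..<N}. \<Sum>F\<in>Pow ?A.
      (\<Prod>\<epsilon>\<in>F. ?eq f \<epsilon> * (b \<epsilon> + ?lt g \<epsilon>)) * (\<Prod>\<epsilon>\<in>?A - F. ?lt f \<epsilon> - b \<epsilon> * ?eq f \<epsilon>))"
    by (subst sum.swap, rule sum.cong[OF refl], rule sum.swap)
  also have "\<dots> = (\<Sum>f\<in>?V \<rightarrow>\<^sub>E {..<M}. \<Sum>g\<in>?V \<rightarrow>\<^sub>E {..<N}. \<Prod>\<epsilon>\<in>?A. ?lex f g \<epsilon>)"
  \<comment> \<open>The sum over the edge sets \<open>F\<close> of \<open>H\<close> is the expansion of a product of two-term sums over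
  all edges of \<open>G\<close>.\<close>
  proof (intro sum.cong refl)
    fix f g :: "'v \<Rightarrow> nat"
    have "?eq f \<epsilon> * (b \<epsilon> + ?lt g \<epsilon>) + (?lt f \<epsilon> - b \<epsilon> * ?eq f \<epsilon>) = ?lex f g \<epsilon>" for \<epsilon>
      by auto
    then show "(\<Sum>F\<in>Pow ?A. (\<Prod>\<epsilon>\<in>F. ?eq f \<epsilon> * (b \<epsilon> + ?lt g \<epsilon>)) *
        (\<Prod>\<epsilon>\<in>?A - F. ?lt f \<epsilon> - b \<epsilon> * ?eq f \<epsilon>)) = (\<Prod>\<epsilon>\<in>?A. ?lex f g \<epsilon>)"
      by (subst prod_add[symmetric]) (rule finite_arcs, simp only:)
  qed
  also have "\<dots> = (\<Sum>(f, g)\<in>(?V \<rightarrow>\<^sub>E {..<M}) \<times> (?V \<rightarrow>\<^sub>E {..<N}). \<Prod>\<epsilon>\<in>?A. ?lex f g \<epsilon>)"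
    by (rule sum.cartesian_product)
  \<comment> \<open>Pairs in \<open>[M] \<times> [N]\<close> with the lexicographic order are the numbers below \<open>M N\<close>, by division
  with remainder by \<open>N\<close>.\<close>
  also have "\<dots> = (\<Sum>f\<in>?V \<rightarrow>\<^sub>E {..<M * N}. cut_weight (\<lambda>_. 0) G f)"
  proof (rule sum.reindex_bij_witness[where i = "\<lambda>f. (\<lambda>v\<in>?V. f v div N, \<lambda>v\<in>?V. f v mod N)"
        and j = "\<lambda>(f, g). \<lambda>v\<in>?V. f v * N + g v"])
    fix p assume "p \<in> (?V \<rightarrow>\<^sub>E {..<M}) \<times> (?V \<rightarrow>\<^sub>E {..<N})"
    then obtain f g where p: "p = (f, g)" "f \<in> ?V \<rightarrow>\<^sub>E {..<M}" "g \<in> ?V \<rightarrow>\<^sub>E {..<N}" by auto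
    then have fg: "f v < M" "g v < N" if "v \<in> ?V" for v using that by auto
    have "(f v * N + g v) div N = f v" "(f v * N + g v) mod N = g v" if "v \<in> ?V" for v
      using fg(2)[OF that] by simp_all
    then have "(\<lambda>v\<in>?V. (f v * N + g v) div N) = f" "(\<lambda>v\<in>?V. (f v * N + g v) mod N) = g"
      using PiE_arb[OF p(2)] PiE_arb[OF p(3)] by (auto simp: fun_eq_iff restrict_def)
    then show "(\<lambda>v\<in>?V. (case p of (f, g) \<Rightarrow> \<lambda>v\<in>?V. f v * N + g v) v div N,
        \<lambda>v\<in>?V. (case p of (f, g) \<Rightarrow> \<lambda>v\<in>?V. f v * N + g v) v mod N) = p"
      by (simp add: p(1) cong: restrict_cong)
    have less: "f v * N + g v < M * N" if "v \<in> ?V" for v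
    proof -
      have "f v * N + g v < Suc (f v) * N" using fg(2)[OF that] by simp
      also have "\<dots> \<le> M * N" using fg(1)[OF that] by (intro mult_le_mono1) simp
      finally show ?thesis .
    qed
    then show "(case p of (f, g) \<Rightarrow> \<lambda>v\<in>?V. f v * N + g v) \<in> ?V \<rightarrow>\<^sub>E {..<M * N}"
      by (simp add: p(1))
    have lex: "f u * N + g u < f v * N + g v \<longleftrightarrow> f u < f v \<or> f u = f v \<and> g u < g v"
      if "u \<in> ?V" "v \<in> ?V" for u v
    proof -
      have *: "x * N + a < y * N + c" if "x < y" "a < N" for x y a c
      proof -
        have "x * N + a < Suc x * N" using that by simp
        also have "\<dots> \<le> y * N" using that by (intro mult_le_mono1) simp
        finally show ?thesis by simp
      qed
      show ?thesis
        using *[of "f u" "f v" "g u" "g v"] *[of "f v" "f u" "g v" "g u"] fg(2)[OF that(1)] fg(2)[OF that(2)]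
        by (cases "f u" "f v" rule: linorder_cases) auto
    qed
    show "cut_weight (\<lambda>_. 0) G (case p of (f, g) \<Rightarrow> \<lambda>v\<in>?V. f v * N + g v) =
        (case p of (f, g) \<Rightarrow> \<Prod>\<epsilon>\<in>?A. ?lex f g \<epsilon>)"
      unfolding cut_weight_def p(1) prod.case by (rule prod.cong) (simp_all add: lex)
  next
    fix f assume f: "f \<in> ?V \<rightarrow>\<^sub>E {..<M * N}"
    then have fv: "f v < M * N" if "v \<in> ?V" for v using that by auto
    then have "N > 0" if "v \<in> ?V" for v using that by (cases N) auto
    then show "(\<lambda>v\<in>?V. f v div N, \<lambda>v\<in>?V. f v mod N) \<in> (?V \<rightarrow>\<^sub>E {..<M}) \<times> (?V \<rightarrow>\<^sub>E {..<N})"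
      using fv by (auto simp: less_mult_imp_div_less)
    show "(case (\<lambda>v\<in>?V. f v div N, \<lambda>v\<in>?V. f v mod N) of (f, g) \<Rightarrow> \<lambda>v\<in>?V. f v * N + g v) = f"
      using PiE_arb[OF f] by (auto simp: fun_eq_iff restrict_def)
  qed
  finally show ?thesis .
qed

text \<open>
  The coefficient of \<open>N\<^sup>c\<close> in \<open>P\<^sub>G\<close>, with \<open>c\<close> the number of components of \<open>G\<close>, satisfies the relation
  that characterizes \<open>\<omega>\<close>. This holds for all finite quivers, with tadpoles and directed cycles
  allowed.
\<close>

lemma is_omega_cut_poly:
  fixes \<beta> :: "'e \<Rightarrow> 'k::field_char_0"
  shows "is_omega \<beta> (\<lambda>G :: ('v, 'e) pre_digraph. if fin_digraph G
    then coeff (count_poly (verts G) (cut_weight (\<lambda>\<epsilon>. beta_sgn \<beta> \<epsilon> (- 1)) G)) (card (components G)) else 0)"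
  unfolding is_omega_def
proof (intro conjI allI impI)
  fix G :: "('v, 'e) pre_digraph"
  assume G: "fin_digraph G"
  interpret fin_digraph G by (rule G)
  let ?b = "\<lambda>\<epsilon>. beta_sgn \<beta> \<epsilon> (- 1)"
  define P where "P H = count_poly (verts H) (cut_weight ?b H)" for H :: "('v, 'e) pre_digraph"
  define K where "K H = contract_quiver G H" for H
  define Q where "Q H = count_poly (components H) (contr_weight ?b (K H))" for H
  define s where "s = count_poly (verts G) (cut_weight (\<lambda>_. 0 :: 'k) G)"
  have finH: "fin_digraph H" "verts H = verts G" if "spanning H G" for H
    using spanning_fin_digraph[OF G that] that by (simp_all add: spanning_def)
  have K: "fin_digraph (K H)" "verts (K H) = components H" if H: "spanning H G" for H
  proof -
    interpret H: fin_digraph H by (rule finH(1)[OF H])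
    have comp: "component_of H v \<in> components H" if "v \<in> verts G" for v
      using that H.component_of_in_components finH(2)[OF H] by simp
    show "fin_digraph (K H)"
      by unfold_locales (auto simp: K_def contract_quiver_def comp finite_components[OF finH(1)[OF H]])
  qed (simp add: K_def contract_quiver_def)
  have Q_eval: "poly (Q H) (of_nat M) = (\<Sum>g\<in>components H \<rightarrow>\<^sub>E {..<M}. contr_weight ?b (K H) g)"
    if H: "spanning H G" for H M
  proof -
    interpret K: fin_digraph "K H" by (rule K(1)[OF H])
    show ?thesis
      using K.order_invariant_contr_weight K.finite_verts unfolding Q_def K(2)[OF H]
      by (intro poly_count_poly)
  qed
  have P_eval: "poly (P H) (of_nat N) = (\<Sum>f\<in>verts G \<rightarrow>\<^sub>E {..<N}. cut_weight ?b H f)"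
    if H: "spanning H G" for H N
  proof -
    interpret H: fin_digraph H by (rule finH(1)[OF H])
    show ?thesis
      using H.order_invariant_cut_weight H.finite_verts unfolding P_def finH(2)[OF H]
      by (intro poly_count_poly)
  qed
  have s_eval: "poly s (of_nat N) = (\<Sum>f\<in>verts G \<rightarrow>\<^sub>E {..<N}. cut_weight (\<lambda>_. 0) G f)" for N
    unfolding s_def by (intro poly_count_poly order_invariant_cut_weight) simp
  have conv: "(\<Sum>H | spanning H G. coeff (Q H) c * coeff (P H) c) = coeff s c" for c
  proof (rule sum_coeff_mult_eq[OF finite_spanning[OF G]])
    fix M N
    have "(\<Sum>H | spanning H G. poly (Q H) (of_nat M) * poly (P H) (of_nat N)) = poly s (of_nat (M * N))"
      using sum_contr_times_cut[OF G, where b = ?b and M = M and N = N] unfolding s_eval K_def[symmetric]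
      by (simp add: Q_eval P_eval)
    then show "(\<Sum>H | spanning H G. poly (Q H) (of_nat M) * poly (P H) (of_nat N)) =
        poly s (of_nat M * of_nat N)" by simp
  qed
  define n where "n = card (verts G)"
  have card_le: "card (components H) \<le> n" if H: "spanning H G" for H
  proof -
    interpret H: fin_digraph H by (rule finH(1)[OF H])
    show ?thesis unfolding H.components_eq_image n_def finH(2)[OF H] by (rule card_image_le) simp
  qed
  \<comment> \<open>Below \<open>card (components H)\<close> the factor \<open>P H\<close> has no coefficients, above it \<open>Q H\<close> has none.\<close>
  have diag: "(\<Sum>c\<le>n. coeff (Q H) c * coeff (P H) c) =
      coeff (P H) (card (components H)) * e_quiver \<beta> (K H)" if H: "spanning H G" for H
  proof -
    let ?c = "card (components H)"
    have "(\<Sum>c\<le>n. coeff (Q H) c * coeff (P H) c) = (\<Sum>c\<in>{?c}. coeff (Q H) c * coeff (P H) c)"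
    proof (rule sum.mono_neutral_right)
      show "\<forall>c\<in>{..n} - {?c}. coeff (Q H) c * coeff (P H) c = 0"
      proof
        fix c assume "c \<in> {..n} - {?c}"
        then consider "c < ?c" | "?c < c" by fastforce
        then show "coeff (Q H) c * coeff (P H) c = 0"
        proof cases
          case 1
          then show ?thesis by (simp add: P_def coeff_cut_poly_low[OF finH(1)[OF H]])
        next
          case 2
          then have "degree (Q H) < c"
            using degree_count_poly_le[of "components H"] unfolding Q_def by (rule le_less_trans[rotated])
          then show ?thesis by (simp add: coeff_eq_0)
        qed
      qed
    qed (use card_le[OF H] in auto)
    moreover have "coeff (Q H) ?c = e_quiver \<beta> (K H)"
      using coeff_contr_poly_top[OF K(1)[OF H], of \<beta>] unfolding Q_def K(2)[OF H] .
    ultimately show ?thesis by (simp add: mult.commute)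
  qed
  have "(\<Sum>H | spanning H G. coeff (P H) (card (components H)) * e_quiver \<beta> (K H)) =
      (\<Sum>H | spanning H G. \<Sum>c\<le>n. coeff (Q H) c * coeff (P H) c)"
    by (rule sum.cong) (simp_all add: diag)
  also have "\<dots> = (\<Sum>c\<le>n. coeff s c)"
    by (subst sum.swap) (simp add: conv)
  also have "\<dots> = (\<Sum>c\<le>degree s. coeff s c)"
    using degree_count_poly_le[of "verts G"]
    by (intro sum.mono_neutral_right) (auto simp: s_def n_def coeff_eq_0 dest: order_trans)
  also have "\<dots> = poly s (of_nat 1)"
    by (simp add: poly_altdef)
  also have "\<dots> = counit G"
  proof -
    \<comment> \<open>There is a single map to \<open>{0}\<close>, and it increases along no edge.\<close>
    have const: "verts G \<rightarrow>\<^sub>E {..<Suc 0} = {\<lambda>v\<in>verts G. 0}"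
      unfolding PiE_eq_singleton by auto
    show ?thesis unfolding s_eval by (simp add: const cut_weight_def counit_def card_gt_0_iff)
  qed
  finally show "(\<Sum>H | spanning H G. (if fin_digraph H
      then coeff (count_poly (verts H) (cut_weight ?b H)) (card (components H)) else 0) *
      e_quiver \<beta> (contract_quiver G H)) = counit G"
    using finH(1) by (simp add: P_def K_def)
qed simp

section \<open>Maps with a given sorting permutation\<close>

lemma sum_choose_shifted:
  assumes "r \<le> n"
  shows "(\<Sum>v<N. (v + r) choose n) = (N + r) choose Suc n"
  using assms by (induction N) simp_all

text \<open>
  The weakly increasing sequences of length \<open>n\<close> with entries below \<open>N\<close> that increase strictly at the
  indices in \<open>D\<close>.
\<close>

definition asc_seqs :: "nat \<Rightarrow> nat set \<Rightarrow> nat \<Rightarrow> (nat \<Rightarrow> nat) set" where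
  "asc_seqs n D N = {g \<in> {1..n} \<rightarrow>\<^sub>E {..<N}.
     \<forall>a\<in>{1..<n}. if a \<in> D then g a < g (Suc a) else g a \<le> g (Suc a)}"

lemma asc_seqsD:
  assumes "g \<in> asc_seqs n D N"
  shows "a \<in> {1..n} \<Longrightarrow> g a < N" "a \<notin> {1..n} \<Longrightarrow> g a = undefined"
    "a \<in> {1..<n} \<Longrightarrow> if a \<in> D then g a < g (Suc a) else g a \<le> g (Suc a)"
  using assms unfolding asc_seqs_def by (blast, blast intro: PiE_arb, blast)

lemma asc_seqs_mono:
  assumes "g \<in> asc_seqs n D N" "1 \<le> a" "a \<le> b" "b \<le> n"
  shows "g a \<le> g b"
  using assms(3,4)
proof (induction b rule: nat_induct_at_least)
  case (Suc b)
  then have "b \<in> {1..<n}" using assms(2) by simp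
  then have "g b \<le> g (Suc b)"
    using asc_seqsD(3)[OF assms(1), of b] by (simp split: if_splits)
  then show ?case using Suc by simp
qed simp

lemma finite_asc_seqs: "finite (asc_seqs n D N)"
  unfolding asc_seqs_def by (rule finite_Collect_conjI) (simp add: finite_PiE)

text \<open>
  By induction on \<open>n\<close>, splitting off the last entry \<open>v\<close>: the other entries are below \<open>v\<close> if \<open>n\<close> is in
  \<open>D\<close>, and at most \<open>v\<close> otherwise.
\<close>

lemma card_asc_seqs:
  assumes "n \<ge> 1" "D \<subseteq> {1..<n}"
  shows "card (asc_seqs n D N) = (N + (n - 1 - card D)) choose n"
  using assms
proof (induction n arbitrary: D N rule: nat_induct_at_least)
  case base
  have "asc_seqs 1 D N = {1} \<rightarrow>\<^sub>E {..<N}" by (auto simp: asc_seqs_def)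
  then show ?case using base by (simp add: card_PiE)
next
  case (Suc n)
  define D' where "D' = D \<inter> {1..<n}"
  define u where "u v = (if n \<in> D then v else Suc v)" for v
  have bij: "bij_betw (\<lambda>g. (g (Suc n), restrict g {1..n})) (asc_seqs (Suc n) D N)
      (SIGMA v:{..<N}. asc_seqs n D' (u v))"
  proof (rule bij_betw_byWitness[where f' = "\<lambda>(v, g). g(Suc n := v)"])
    show "\<forall>g\<in>asc_seqs (Suc n) D N. (\<lambda>(v, g). g(Suc n := v)) (g (Suc n), restrict g {1..n}) = g"
      by (auto simp: asc_seqs_def fun_eq_iff PiE_def extensional_def)
    show "\<forall>p\<in>SIGMA v:{..<N}. asc_seqs n D' (u v).
        (((\<lambda>(v, g). g(Suc n := v)) p) (Suc n), restrict ((\<lambda>(v, g). g(Suc n := v)) p) {1..n}) = p"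
      by (auto simp: asc_seqs_def fun_eq_iff PiE_def extensional_def)
    show "(\<lambda>g. (g (Suc n), restrict g {1..n})) ` asc_seqs (Suc n) D N \<subseteq> (SIGMA v:{..<N}. asc_seqs n D' (u v))"
    proof (rule image_subsetI)
      fix g assume g: "g \<in> asc_seqs (Suc n) D N"
      then have "g (Suc n) < N" by (auto simp: asc_seqs_def)
      moreover have "g a < u (g (Suc n))" if "a \<in> {1..n}" for a
      proof -
        have "g a \<le> g n" using asc_seqs_mono[OF g] that by simp
        moreover have "g n < u (g (Suc n))"
          using g Suc.hyps by (auto simp: asc_seqs_def u_def split: if_splits)
        ultimately show ?thesis by simp
      qed
      moreover have "if a \<in> D' then g a < g (Suc a) else g a \<le> g (Suc a)" if "a \<in> {1..<n}" for a
        using g that by (auto simp: asc_seqs_def D'_def split: if_splits)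
      ultimately show "(g (Suc n), restrict g {1..n}) \<in> (SIGMA v:{..<N}. asc_seqs n D' (u v))"
        by (auto simp: asc_seqs_def)
    qed
    show "(\<lambda>(v, g). g(Suc n := v)) ` (SIGMA v:{..<N}. asc_seqs n D' (u v)) \<subseteq> asc_seqs (Suc n) D N"
    proof (rule image_subsetI)
      fix p assume "p \<in> (SIGMA v:{..<N}. asc_seqs n D' (u v))"
      then obtain v g where p: "p = (v, g)" "v < N" and g: "g \<in> asc_seqs n D' (u v)" by auto
      have lt: "g a < u v" if "a \<in> {1..n}" for a using g that by (auto simp: asc_seqs_def)
      then have "g a < N" if "a \<in> {1..n}" for a
        using that p(2) by (fastforce simp: u_def split: if_splits)
      moreover have "g a = undefined" if "a \<notin> {1..n}" for a
        using g that by (auto simp: asc_seqs_def PiE_def extensional_def)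
      ultimately have "g(Suc n := v) \<in> {1..Suc n} \<rightarrow>\<^sub>E {..<N}"
        using p(2) by (auto simp: PiE_def extensional_def Pi_def le_Suc_eq)
      moreover have "if a \<in> D then (g(Suc n := v)) a < (g(Suc n := v)) (Suc a)
          else (g(Suc n := v)) a \<le> (g(Suc n := v)) (Suc a)" if a: "a \<in> {1..<Suc n}" for a
      proof (cases "a = n")
        case True
        then show ?thesis using lt[of n] a by (auto simp: u_def split: if_splits)
      next
        case False
        then have "a \<in> {1..<n}" using a by auto
        then show ?thesis using g by (auto simp: asc_seqs_def D'_def split: if_splits)
      qed
      ultimately show "(\<lambda>(v, g). g(Suc n := v)) p \<in> asc_seqs (Suc n) D N"
        unfolding asc_seqs_def p(1) prod.case by blast
    qed
  qed
  have D': "D' \<subseteq> {1..<n}" "card D' \<le> n - 1"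
    using card_mono[of "{1..<n}" D'] by (auto simp: D'_def)
  have "card (asc_seqs (Suc n) D N) = (\<Sum>v<N. (u v + (n - 1 - card D')) choose n)"
    unfolding bij_betw_same_card[OF bij]
    using Suc.IH[OF D'(1)] by (simp add: card_SigmaI finite_asc_seqs)
  also have "\<dots> = (N + (Suc n - 1 - card D)) choose Suc n"
  proof (cases "n \<in> D")
    case True
    then have "D = insert n D'" using Suc.prems by (auto simp: D'_def less_Suc_eq)
    moreover have "n \<notin> D'" "finite D'" by (auto simp: D'_def)
    ultimately have "card D = Suc (card D')" by simp
    then show ?thesis using sum_choose_shifted[of "n - 1 - card D'" n N] True by (simp add: u_def)
  next
    case False
    then have "D = D'" using Suc.prems by (auto simp: D'_def less_Suc_eq)
    have "u v + (n - 1 - card D') = v + (n - card D')" for v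
      using False D'(2) Suc.hyps by (simp add: u_def)
    then show ?thesis using sum_choose_shifted[of "n - card D'" n N] \<open>D = D'\<close> by simp
  qed
  finally show ?case .
qed

text \<open>
  The permutation \<open>\<sigma>\<close> lists \<open>1,\<dots>,n\<close> in the order of increasing values of \<open>f\<close>, and elements with the
  same value in increasing order.
\<close>

definition sorts :: "nat \<Rightarrow> (nat \<Rightarrow> nat) \<Rightarrow> (nat \<Rightarrow> nat) \<Rightarrow> bool" where
  "sorts n \<sigma> f \<longleftrightarrow> (\<forall>a\<in>{1..<n}. f (\<sigma> a) < f (\<sigma> (Suc a)) \<or>
      f (\<sigma> a) = f (\<sigma> (Suc a)) \<and> \<sigma> a < \<sigma> (Suc a))"

lemma sorts_less:
  assumes "sorts n \<sigma> f" "1 \<le> a" "a < b" "b \<le> n"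
  shows "f (\<sigma> a) < f (\<sigma> b) \<or> f (\<sigma> a) = f (\<sigma> b) \<and> \<sigma> a < \<sigma> b"
  using assms(3,4)
proof (induction b)
  case (Suc b)
  then have "b \<in> {1..<n}" using assms(2) by simp
  then have "f (\<sigma> b) < f (\<sigma> (Suc b)) \<or> f (\<sigma> b) = f (\<sigma> (Suc b)) \<and> \<sigma> b < \<sigma> (Suc b)"
    using assms(1) by (simp add: sorts_def)
  moreover have "a = b \<or> f (\<sigma> a) < f (\<sigma> b) \<or> f (\<sigma> a) = f (\<sigma> b) \<and> \<sigma> a < \<sigma> b"
    using Suc by auto
  ultimately show ?case by auto
qed simp

lemma ex1_sorts: "\<exists>!\<sigma>. \<sigma> permutes {1..n} \<and> sorts n \<sigma> f"
proof -
  \<comment> \<open>The key encodes the pair \<open>(f i, i)\<close> with the lexicographic order, so that \<open>\<sigma>\<close> has to list the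
  keys in increasing order.\<close>
  define key where "key i = f i * Suc n + i" for i
  have key_less: "key i < key j \<longleftrightarrow> f i < f j \<or> f i = f j \<and> i < j"
    if "i \<in> {1..n}" "j \<in> {1..n}" for i j
  proof -
    have *: "x * Suc n + a < y * Suc n + c" if "x < y" "a \<le> n" for x y a c
    proof -
      have "x * Suc n + a < Suc x * Suc n" using that by simp
      also have "\<dots> \<le> y * Suc n" using that by (intro mult_le_mono1) simp
      finally show ?thesis by simp
    qed
    show ?thesis
      using *[of "f i" "f j" i j] *[of "f j" "f i" j i] that
      unfolding key_def by (cases "f i" "f j" rule: linorder_cases) auto
  qed
  have key_inj: "inj_on key {1..n}"
    by (rule linorder_inj_onI') (use key_less in \<open>metis less_irrefl linorder_less_linear\<close>)
  have sorts_iff: "sorts n \<sigma> f \<longleftrightarrow> (\<forall>a\<in>{1..<n}. key (\<sigma> a) < key (\<sigma> (Suc a)))"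
    if "\<sigma> permutes {1..n}" for \<sigma>
  proof -
    have "\<sigma> a \<in> {1..n}" if "a \<in> {1..n}" for a
      using permutes_in_image[OF \<open>\<sigma> permutes {1..n}\<close>] that by blast
    then show ?thesis unfolding sorts_def by (intro ball_cong refl) (simp add: key_less)
  qed
  show ?thesis
  proof (rule ex_ex1I)
    obtain h where h: "bij_betw h {..<card (key ` {1..n})} (key ` {1..n})"
      and mono: "strict_mono_on {..<card (key ` {1..n})} h"
      using ex_bij_betw_strict_mono_card[of "key ` {1..n}"] by auto
    have card: "card (key ` {1..n}) = n" using key_inj by (simp add: card_image)
    define \<sigma> where "\<sigma> a = (if a \<in> {1..n} then inv_into {1..n} key (h (a - 1)) else a)" for a
    have "bij_betw (\<lambda>a. a - 1) {1..n} {..<n}"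
      by (rule bij_betw_byWitness[where f' = Suc]) auto
    then have "bij_betw (inv_into {1..n} key \<circ> (h \<circ> (\<lambda>a. a - 1))) {1..n} {1..n}"
      using h card key_inj
      by (intro bij_betw_trans[where B = "key ` {1..n}"] bij_betw_trans[where B = "{..<n}"]
          bij_betw_inv_into) (simp_all add: bij_betw_def)
    then have "bij_betw \<sigma> {1..n} {1..n}"
      by (rule bij_betw_cong[THEN iffD1, rotated]) (simp add: \<sigma>_def)
    then have perm: "\<sigma> permutes {1..n}"
      by (rule bij_imp_permutes) (auto simp: \<sigma>_def)
    have "key (\<sigma> a) = h (a - 1)" if "a \<in> {1..n}" for a
    proof -
      have "h (a - 1) \<in> key ` {1..n}"
        using h card that by (auto simp: bij_betw_def)
      then show ?thesis using that by (simp add: \<sigma>_def f_inv_into_f)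
    qed
    moreover have "h (a - 1) < h a" if "a \<in> {1..<n}" for a
      using strict_mono_onD[OF mono, of "a - 1" a] that card by auto
    ultimately have "sorts n \<sigma> f"
      unfolding sorts_iff[OF perm] by simp
    then show "\<exists>\<sigma>. \<sigma> permutes {1..n} \<and> sorts n \<sigma> f" using perm by blast
  next
    \<comment> \<open>The position of an element is determined by the number of smaller keys.\<close>
    have rank: "card {j \<in> {1..n}. key j < key (\<sigma> a)} = a - 1"
      if \<sigma>: "\<sigma> permutes {1..n} \<and> sorts n \<sigma> f" and a: "a \<in> {1..n}" for \<sigma> a
    proof -
      have mem: "\<sigma> b \<in> {1..n}" if "b \<in> {1..n}" for b
        using permutes_in_image[OF conjunct1[OF \<sigma>]] that by blast
      have less: "key (\<sigma> b) < key (\<sigma> c)" if "1 \<le> b" "b < c" "c \<le> n" for b c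
      proof -
        have "\<sigma> b \<in> {1..n}" "\<sigma> c \<in> {1..n}" using mem that by auto
        then show ?thesis using sorts_less[OF conjunct2[OF \<sigma>] that] by (simp only: key_less)
      qed
      have "{j \<in> {1..n}. key j < key (\<sigma> a)} = \<sigma> ` {1..<a}"
      proof (intro set_eqI iffI)
        fix j assume j: "j \<in> {j \<in> {1..n}. key j < key (\<sigma> a)}"
        then have "j \<in> \<sigma> ` {1..n}" using permutes_image[OF conjunct1[OF \<sigma>]] by blast
        then obtain b where b: "j = \<sigma> b" "b \<in> {1..n}" by blast
        then have "b < a" using less[of a b] j a by (cases a b rule: linorder_cases) auto
        then show "j \<in> \<sigma> ` {1..<a}" using b by auto
      next
        fix j assume "j \<in> \<sigma> ` {1..<a}"
        then obtain b where b: "j = \<sigma> b" "1 \<le> b" "b < a" by auto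
        then have "b \<in> {1..n}" using a by auto
        then show "j \<in> {j \<in> {1..n}. key j < key (\<sigma> a)}"
          using mem[of b] less[of b a] a b by simp
      qed
      moreover have "inj_on \<sigma> {1..<a}"
        using permutes_inj[OF conjunct1[OF \<sigma>]] by (rule inj_on_subset) simp
      ultimately show ?thesis by (simp add: card_image)
    qed
    fix \<sigma> \<tau>
    assume \<sigma>: "\<sigma> permutes {1..n} \<and> sorts n \<sigma> f" and \<tau>: "\<tau> permutes {1..n} \<and> sorts n \<tau> f"
    show "\<sigma> = \<tau>"
    proof
      fix a
      show "\<sigma> a = \<tau> a"
      proof (cases "a \<in> {1..n}")
        case True
        then have "\<sigma> a \<in> \<tau> ` {1..n}"
          unfolding permutes_image[OF conjunct1[OF \<tau>]] permutes_in_image[OF conjunct1[OF \<sigma>]] .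
        then obtain b where b: "\<sigma> a = \<tau> b" "b \<in> {1..n}" by blast
        then have "a - 1 = b - 1" using rank[OF \<sigma> True] rank[OF \<tau> b(2)] by simp
        then have "a = b" using True b(2) by auto
        then show ?thesis using b by simp
      next
        case False
        then show ?thesis
          using permutes_not_in[OF conjunct1[OF \<sigma>]] permutes_not_in[OF conjunct1[OF \<tau>]] by metis
      qed
    qed
  qed
qed

lemma num_descents_le: "num_descents n \<sigma> \<le> n - 1"
proof -
  have "num_descents n \<sigma> \<le> card {1..<n}"
    unfolding num_descents_def by (rule card_mono) auto
  then show ?thesis by simp
qed

lemma card_sorted_by:
  assumes "n \<ge> 1" and \<sigma>: "\<sigma> permutes {1..n}"
  shows "card {f \<in> {1..n} \<rightarrow>\<^sub>E {..<N}. sorts n \<sigma> f} = (N + (n - 1 - num_descents n \<sigma>)) choose n"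
proof -
  define D where "D = {a \<in> {1..<n}. \<sigma> a > \<sigma> (a + 1)}"
  have mem: "\<sigma> a \<in> {1..n} \<longleftrightarrow> a \<in> {1..n}" and mem': "inv \<sigma> a \<in> {1..n} \<longleftrightarrow> a \<in> {1..n}" for a
    using permutes_in_image[OF \<sigma>] permutes_in_image[OF permutes_inv[OF \<sigma>]] by blast+
  have inv: "\<sigma> (inv \<sigma> a) = a" "inv \<sigma> (\<sigma> a) = a" for a
    using permutes_inverses[OF \<sigma>] by simp_all
  have iff: "sorts n \<sigma> f \<longleftrightarrow>
      (\<forall>a\<in>{1..<n}. if a \<in> D then f (\<sigma> a) < f (\<sigma> (Suc a)) else f (\<sigma> a) \<le> f (\<sigma> (Suc a)))" for f
  proof -
    have "\<sigma> a \<noteq> \<sigma> (Suc a)" for a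
      using permutes_inj[OF \<sigma>] by (simp add: inj_eq)
    then show ?thesis unfolding sorts_def D_def
      by (intro ball_cong refl) (auto simp: order_le_less linorder_neq_iff)
  qed
  have "bij_betw (\<lambda>f. \<lambda>a\<in>{1..n}. f (\<sigma> a)) {f \<in> {1..n} \<rightarrow>\<^sub>E {..<N}. sorts n \<sigma> f} (asc_seqs n D N)"
  proof (rule bij_betw_byWitness[where f' = "\<lambda>g. \<lambda>i\<in>{1..n}. g (inv \<sigma> i)"])
    show "\<forall>f\<in>{f \<in> {1..n} \<rightarrow>\<^sub>E {..<N}. sorts n \<sigma> f}.
        (\<lambda>i\<in>{1..n}. (\<lambda>a\<in>{1..n}. f (\<sigma> a)) (inv \<sigma> i)) = f"
      using mem' by (simp add: inv fun_eq_iff restrict_def PiE_def extensional_def)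
    show "\<forall>g\<in>asc_seqs n D N. (\<lambda>a\<in>{1..n}. (\<lambda>i\<in>{1..n}. g (inv \<sigma> i)) (\<sigma> a)) = g"
      using mem by (simp add: inv fun_eq_iff restrict_def PiE_def extensional_def asc_seqs_def)
    show "(\<lambda>f. \<lambda>a\<in>{1..n}. f (\<sigma> a)) ` {f \<in> {1..n} \<rightarrow>\<^sub>E {..<N}. sorts n \<sigma> f} \<subseteq> asc_seqs n D N"
      using mem by (auto simp: iff asc_seqs_def Pi_def PiE_def)
    show "(\<lambda>g. \<lambda>i\<in>{1..n}. g (inv \<sigma> i)) ` asc_seqs n D N \<subseteq> {f \<in> {1..n} \<rightarrow>\<^sub>E {..<N}. sorts n \<sigma> f}"
    proof (rule image_subsetI)
      fix g assume g: "g \<in> asc_seqs n D N"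
      have *: "(\<lambda>i\<in>{1..n}. g (inv \<sigma> i)) (\<sigma> a) = g a" if "a \<in> {1..n}" for a
        using mem[of a] that by (simp add: inv)
      have "sorts n \<sigma> (\<lambda>i\<in>{1..n}. g (inv \<sigma> i))"
        unfolding iff
      proof
        fix a assume a: "a \<in> {1..<n}"
        then have "a \<in> {1..n}" "Suc a \<in> {1..n}" by auto
        then show "if a \<in> D then (\<lambda>i\<in>{1..n}. g (inv \<sigma> i)) (\<sigma> a) < (\<lambda>i\<in>{1..n}. g (inv \<sigma> i)) (\<sigma> (Suc a))
          else (\<lambda>i\<in>{1..n}. g (inv \<sigma> i)) (\<sigma> a) \<le> (\<lambda>i\<in>{1..n}. g (inv \<sigma> i)) (\<sigma> (Suc a))"
          using asc_seqsD(3)[OF g a] by (simp only: *)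
      qed
      moreover have "g (inv \<sigma> i) \<in> {..<N}" if "i \<in> {1..n}" for i
        using asc_seqsD(1)[OF g, of "inv \<sigma> i"] mem'[of i] that by blast
      ultimately show "(\<lambda>i\<in>{1..n}. g (inv \<sigma> i)) \<in> {f \<in> {1..n} \<rightarrow>\<^sub>E {..<N}. sorts n \<sigma> f}"
        by auto
    qed
  qed
  then have "card {f \<in> {1..n} \<rightarrow>\<^sub>E {..<N}. sorts n \<sigma> f} = card (asc_seqs n D N)"
    by (rule bij_betw_same_card)
  also have "\<dots> = (N + (n - 1 - card D)) choose n"
    by (rule card_asc_seqs) (use assms(1) in \<open>auto simp: D_def\<close>)
  finally show ?thesis by (simp add: D_def num_descents_def)
qed

text \<open>
  The binomial coefficient \<open>x + j choose n\<close> as a polynomial in \<open>x\<close>.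
\<close>

definition sort_poly :: "nat \<Rightarrow> nat \<Rightarrow> 'k::field_char_0 poly" where
  "sort_poly n j = smult (1 / fact n) (\<Prod>i<n. [:of_nat j - of_nat i, 1:])"

lemma poly_sort_poly: "poly (sort_poly n j) (of_nat N) = of_nat ((N + j) choose n)"
  by (simp add: sort_poly_def poly_prod binomial_gbinomial gbinomial_prod_rev
      atLeast0LessThan algebra_simps)

lemma coeff_sort_poly_1:
  assumes "j < n"
  shows "coeff (sort_poly n j :: 'k::field_char_0 poly) 1 = c_coeff n (n - 1 - j)"
proof -
  define k where "k = n - 1 - j"
  have n: "n = Suc (j + k)" using assms by (simp add: k_def)
  \<comment> \<open>The factor with \<open>i = j\<close> is the indeterminate, so the linear coefficient is the product of the
  constant terms of the other factors.\<close>
  have "(\<Prod>i<n. [:of_nat j - of_nat i, 1::'k:]) =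
      [:0, 1:] * (\<Prod>i\<in>{..<n} - {j}. [:of_nat j - of_nat i, 1:])"
    using assms by (subst prod.remove[of _ j]) simp_all
  then have "coeff (\<Prod>i<n. [:of_nat j - of_nat i, 1::'k:]) 1 =
      poly (\<Prod>i\<in>{..<n} - {j}. [:of_nat j - of_nat i, 1:]) 0"
    by (simp add: poly_0_coeff_0)
  also have "\<dots> = (\<Prod>i\<in>{..<n} - {j}. of_nat j - of_nat i)"
    by (simp add: poly_prod)
  also have "{..<n} - {j} = {..<j} \<union> Suc ` (\<lambda>i. j + i) ` {..<k}"
  proof -
    have "x \<in> Suc ` (\<lambda>i. j + i) ` {..<k}" if "j < x" "x < n" for x
      using that by (intro image_eqI[where x = "x - 1"] image_eqI[where x = "x - 1 - j"]) (auto simp: n)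
    then show ?thesis by (auto simp: n not_less linorder_neq_iff)
  qed
  also have "(\<Prod>i\<in>{..<j} \<union> Suc ` (\<lambda>i. j + i) ` {..<k}. of_nat j - of_nat i :: 'k) =
      (\<Prod>i<j. of_nat j - of_nat i) * (\<Prod>i<k. - of_nat (Suc i))"
    by (subst prod.union_disjoint) (auto simp: prod.reindex inj_on_def)
  also have "(\<Prod>i<j. of_nat j - of_nat i :: 'k) = fact j"
    unfolding fact_prod_rev of_nat_prod by (rule prod.cong) (auto simp: of_nat_diff)
  also have "(\<Prod>i<k. - of_nat (Suc i) :: 'k) = (- 1) ^ k * fact k"
    unfolding prod_uminus by (simp add: fact_prod_Suc atLeast0LessThan del: of_nat_Suc)
  finally have "coeff (sort_poly n j :: 'k poly) 1 = fact j * ((- 1) ^ k * fact k) / fact n"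
    by (simp add: sort_poly_def)
  also have "\<dots> = c_coeff n k"
    by (simp add: c_coeff_def n binomial_fact field_simps)
  finally show ?thesis by (simp add: k_def)
qed

section \<open>The sum over permutations as a linear coefficient\<close>

text \<open>
  If an edge has its head before its tail in \<open>\<sigma>\<close>, then \<open>f\<close> does not increase along it. If its tail
  comes first, then \<open>f\<close> increases strictly, since the head has the smaller label and a tie would
  have placed the head first.
\<close>

lemma cut_weight_sorted:
  fixes \<beta> :: "'e \<Rightarrow> 'k::field_char_0" and G :: "(nat, 'e) pre_digraph"
  assumes "wf_digraph G" and V: "verts G = {1..n}"
    and head_less: "\<And>\<epsilon>. \<epsilon> \<in> arcs G \<Longrightarrow> head G \<epsilon> < tail G \<epsilon>"
    and \<sigma>: "\<sigma> permutes {1..n}" and sorts: "sorts n \<sigma> f"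
  shows "cut_weight (\<lambda>\<epsilon>. beta_sgn \<beta> \<epsilon> (- 1)) G f =
    (\<Prod>\<epsilon>\<in>arcs G. beta_sgn \<beta> \<epsilon> (- edge_sign G \<sigma> \<epsilon>))"
  unfolding cut_weight_def
proof (rule prod.cong[OF refl])
  fix \<epsilon> assume \<epsilon>: "\<epsilon> \<in> arcs G"
  interpret wf_digraph G by fact
  let ?h = "head G \<epsilon>" and ?t = "tail G \<epsilon>"
  have inv: "\<sigma> (inv \<sigma> i) = i" for i using permutes_inverses[OF \<sigma>] by simp
  have mem: "inv \<sigma> i \<in> {1..n}" if "i \<in> {1..n}" for i
    using permutes_in_image[OF permutes_inv[OF \<sigma>]] that by blast
  have ht: "inv \<sigma> ?h \<in> {1..n}" "inv \<sigma> ?t \<in> {1..n}"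
    using \<epsilon> head_in_verts tail_in_verts mem unfolding V by blast+
  show "beta_sgn \<beta> \<epsilon> (- 1) + of_bool (f ?t < f ?h) = beta_sgn \<beta> \<epsilon> (- edge_sign G \<sigma> \<epsilon>)"
  proof (cases "inv \<sigma> ?h" "inv \<sigma> ?t" rule: linorder_cases)
    case less
    then have "\<not> f ?t < f ?h"
      using sorts_less[OF sorts, of "inv \<sigma> ?h" "inv \<sigma> ?t"] ht by (auto simp: inv)
    then show ?thesis using less by (simp add: edge_sign_def pos_def)
  next
    case equal
    then have "?h = ?t" using inv by metis
    then show ?thesis using head_less[OF \<epsilon>] by simp
  next
    case greater
    then have "f ?t < f ?h"
      using sorts_less[OF sorts, of "inv \<sigma> ?t" "inv \<sigma> ?h"] ht head_less[OF \<epsilon>] by (auto simp: inv)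
    then show ?thesis using greater by (simp add: edge_sign_def pos_def beta_sgn_def field_simps)
  qed
qed

lemma Omega_op_eq_coeff:
  fixes \<beta> :: "'e \<Rightarrow> 'k::field_char_0" and G :: "(nat, 'e) pre_digraph"
  assumes "wf_digraph G" and V: "verts G = {1..n}" and n: "n \<ge> 1"
    and head_less: "\<And>\<epsilon>. \<epsilon> \<in> arcs G \<Longrightarrow> head G \<epsilon> < tail G \<epsilon>"
  shows "Omega_op \<beta> n G = coeff (count_poly {1..n} (cut_weight (\<lambda>\<epsilon>. beta_sgn \<beta> \<epsilon> (- 1)) G)) 1"
proof -
  interpret wf_digraph G by fact
  let ?w = "cut_weight (\<lambda>\<epsilon>. beta_sgn \<beta> \<epsilon> (- 1)) G" and ?S = "{\<sigma>. \<sigma> permutes {1..n}}"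
  define W where "W \<sigma> = (\<Prod>\<epsilon>\<in>arcs G. beta_sgn \<beta> \<epsilon> (- edge_sign G \<sigma> \<epsilon>))" for \<sigma>
  \<comment> \<open>The sorting permutation of \<open>f\<close>.\<close>
  define std where "std f = (THE \<sigma>. \<sigma> permutes {1..n} \<and> sorts n \<sigma> f)" for f
  have std: "std f permutes {1..n}" "sorts n (std f) f" for f
    using theI'[OF ex1_sorts[of n f]] by (simp_all add: std_def)
  have std_eq: "std f = \<sigma> \<longleftrightarrow> sorts n \<sigma> f" if "\<sigma> permutes {1..n}" for f \<sigma>
    using std[of f] that ex1_sorts[of n f] by blast
  have finS: "finite ?S" by (rule finite_permutations) simp
  have "count_poly {1..n} ?w = (\<Sum>\<sigma>\<in>?S. smult (W \<sigma>) (sort_poly n (n - 1 - num_descents n \<sigma>)))"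
  proof (rule poly_eqI_of_nat)
    fix N :: nat
    let ?F = "{1..n} \<rightarrow>\<^sub>E {..<N}"
    have finF: "finite ?F" by (rule finite_PiE) auto
    have "poly (count_poly {1..n} ?w) (of_nat N) = (\<Sum>f\<in>?F. ?w f)"
      by (rule poly_count_poly[OF _ order_invariant_cut_weight[unfolded V]]) simp
    also have "\<dots> = (\<Sum>\<sigma>\<in>?S. \<Sum>f | f \<in> ?F \<and> std f = \<sigma>. ?w f)"
      by (rule sum.group[symmetric]) (use finF finS std(1) in auto)
    also have "\<dots> = (\<Sum>\<sigma>\<in>?S. \<Sum>f\<in>{f \<in> ?F. sorts n \<sigma> f}. W \<sigma>)"
    proof (intro sum.cong refl)
      fix \<sigma> assume "\<sigma> \<in> ?S"
      then have \<sigma>: "\<sigma> permutes {1..n}" by simp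
      then show "{f. f \<in> ?F \<and> std f = \<sigma>} = {f \<in> ?F. sorts n \<sigma> f}" by (simp only: std_eq)
      fix f assume "f \<in> {f \<in> ?F. sorts n \<sigma> f}"
      then have "sorts n \<sigma> f" by blast
      then show "?w f = W \<sigma>"
        unfolding W_def by (intro cut_weight_sorted[OF assms(1) V head_less \<sigma>])
    qed
    also have "\<dots> = (\<Sum>\<sigma>\<in>?S. W \<sigma> * of_nat ((N + (n - 1 - num_descents n \<sigma>)) choose n))"
      by (rule sum.cong) (simp_all add: card_sorted_by[OF n, simplified] mult.commute)
    also have "\<dots> = poly (\<Sum>\<sigma>\<in>?S. smult (W \<sigma>) (sort_poly n (n - 1 - num_descents n \<sigma>))) (of_nat N)"
      by (simp add: poly_sum poly_sort_poly)
    finally show "poly (count_poly {1..n} ?w) (of_nat N) =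
        poly (\<Sum>\<sigma>\<in>?S. smult (W \<sigma>) (sort_poly n (n - 1 - num_descents n \<sigma>))) (of_nat N)" .
  qed
  then have "coeff (count_poly {1..n} ?w) 1 =
      (\<Sum>\<sigma>\<in>?S. W \<sigma> * coeff (sort_poly n (n - 1 - num_descents n \<sigma>)) 1)"
    by (simp add: coeff_sum)
  also have "\<dots> = (\<Sum>\<sigma>\<in>?S. c_coeff n (num_descents n \<sigma>) * W \<sigma>)"
  proof (intro sum.cong refl)
    fix \<sigma>
    have "n - 1 - num_descents n \<sigma> < n" "n - 1 - (n - 1 - num_descents n \<sigma>) = num_descents n \<sigma>"
      using num_descents_le[of n \<sigma>] n by simp_all
    then show "W \<sigma> * coeff (sort_poly n (n - 1 - num_descents n \<sigma>)) 1 =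
        c_coeff n (num_descents n \<sigma>) * W \<sigma>"
      by (simp only: coeff_sort_poly_1 mult.commute)
  qed
  finally show ?thesis by (simp add: Omega_op_def W_def)
qed

section \<open>Reversal of permutations\<close>

text \<open>
  The permutation \<open>a \<mapsto> n + 1 - a\<close> of \<open>{1,\<dots>,n}\<close>.
\<close>

definition reversal :: "nat \<Rightarrow> nat \<Rightarrow> nat" where
  "reversal n a = (if a \<in> {1..n} then n + 1 - a else a)"

lemma reversal_reversal: "reversal n (reversal n a) = a"
  by (auto simp: reversal_def)

lemma reversal_permutes: "reversal n permutes {1..n}"
proof (rule bij_imp_permutes)
  show "bij_betw (reversal n) {1..n} {1..n}"
    by (rule bij_betw_byWitness[where f' = "reversal n"])
      (simp_all add: reversal_reversal, auto simp: reversal_def)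
qed (auto simp: reversal_def)

lemma c_coeff_reflect: "k \<le> n - 1 \<Longrightarrow> c_coeff n (n - 1 - k) = d_coeff n k"
  unfolding c_coeff_def d_coeff_def by (subst binomial_symmetric[of k "n - 1"]) simp_all

lemma num_descents_reversal:
  assumes "\<sigma> permutes {1..n}"
  shows "num_descents n (\<sigma> \<circ> reversal n) = n - 1 - num_descents n \<sigma>"
proof -
  let ?D = "{a \<in> {1..<n}. \<sigma> a > \<sigma> (a + 1)}" and ?A = "{a \<in> {1..<n}. \<sigma> a < \<sigma> (a + 1)}"
  have "\<sigma> a \<noteq> \<sigma> (a + 1)" for a
    using permutes_inj[OF assms] by (simp add: inj_eq)
  then have "?D \<union> ?A = {1..<n}" by (auto simp: linorder_neq_iff)
  moreover have "card (?D \<union> ?A) = card ?D + card ?A"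
    by (rule card_Un_disjoint) auto
  ultimately have "card ?D + card ?A = n - 1" by simp
  moreover have "num_descents n (\<sigma> \<circ> reversal n) = card ?A"
    unfolding num_descents_def
  proof (rule bij_betw_same_card)
    have *: "reversal n a = Suc (n - a)" "reversal n (a + 1) = n - a" if "a \<in> {1..<n}" for a
      using that by (auto simp: reversal_def)
    show "bij_betw (\<lambda>a. n - a) {a \<in> {1..<n}. (\<sigma> \<circ> reversal n) (a + 1) < (\<sigma> \<circ> reversal n) a} ?A"
    proof (rule bij_betw_byWitness[where f' = "\<lambda>a. n - a"])
      show "(\<lambda>a. n - a) ` {a \<in> {1..<n}. (\<sigma> \<circ> reversal n) (a + 1) < (\<sigma> \<circ> reversal n) a} \<subseteq> ?A"
      proof (rule image_subsetI)
        fix a assume "a \<in> {a \<in> {1..<n}. (\<sigma> \<circ> reversal n) (a + 1) < (\<sigma> \<circ> reversal n) a}"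
        then have a: "a \<in> {1..<n}" and "\<sigma> (reversal n (a + 1)) < \<sigma> (reversal n a)" by auto
        then have "\<sigma> (n - a) < \<sigma> (Suc (n - a))" by (simp only: *)
        then show "n - a \<in> ?A" using a by auto
      qed
      show "(\<lambda>a. n - a) ` ?A \<subseteq> {a \<in> {1..<n}. (\<sigma> \<circ> reversal n) (a + 1) < (\<sigma> \<circ> reversal n) a}"
      proof (rule image_subsetI)
        fix a assume "a \<in> ?A"
        then have a: "a \<in> {1..<n}" "n - a \<in> {1..<n}" "n - (n - a) = a" and "\<sigma> a < \<sigma> (Suc a)" by auto
        then have "\<sigma> (reversal n (n - a + 1)) < \<sigma> (reversal n (n - a))"
          by (simp only: *[OF a(2)])
        then show "n - a \<in> {a \<in> {1..<n}. (\<sigma> \<circ> reversal n) (a + 1) < (\<sigma> \<circ> reversal n) a}"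
          using a(2) by simp
      qed
    qed auto
  qed
  ultimately show ?thesis by (simp add: num_descents_def)
qed

lemma edge_sign_reversal:
  assumes "wf_digraph G" and V: "verts G = {1..n}" and "\<epsilon> \<in> arcs G" and "head G \<epsilon> \<noteq> tail G \<epsilon>"
    and \<sigma>: "\<sigma> permutes {1..n}"
  shows "edge_sign G (\<sigma> \<circ> reversal n) \<epsilon> = - edge_sign G \<sigma> \<epsilon>"
proof -
  interpret wf_digraph G by fact
  have "inv (reversal n) = reversal n"
    by (rule inv_unique_comp) (simp_all add: fun_eq_iff reversal_reversal)
  then have pos: "pos (\<sigma> \<circ> reversal n) i = reversal n (pos \<sigma> i)" for i
    using o_inv_distrib[OF permutes_bij[OF \<sigma>] permutes_bij[OF reversal_permutes]]
    by (simp add: pos_def)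
  have mem: "pos \<sigma> i \<in> {1..n}" if "i \<in> {1..n}" for i
    using permutes_in_image[OF permutes_inv[OF \<sigma>]] that unfolding pos_def by blast
  have "pos \<sigma> (head G \<epsilon>) \<in> {1..n}" "pos \<sigma> (tail G \<epsilon>) \<in> {1..n}"
    using mem assms(3) head_in_verts tail_in_verts unfolding V by blast+
  moreover have "pos \<sigma> (head G \<epsilon>) \<noteq> pos \<sigma> (tail G \<epsilon>)"
    using permutes_inj[OF permutes_inv[OF \<sigma>]] assms(4) by (simp add: pos_def inj_eq)
  ultimately show ?thesis
    by (auto simp: edge_sign_def pos reversal_def)
qed

lemma Omega_op_eq_Omega_bar:
  fixes \<beta> :: "'e \<Rightarrow> 'k::field_char_0" and G :: "(nat, 'e) pre_digraph"
  assumes "wf_digraph G" and V: "verts G = {1..n}"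
    and noloop: "\<And>\<epsilon>. \<epsilon> \<in> arcs G \<Longrightarrow> head G \<epsilon> \<noteq> tail G \<epsilon>"
  shows "Omega_op \<beta> n G = Omega_bar \<beta> n G"
  unfolding Omega_op_def Omega_bar_def
proof (rule sum.reindex_bij_witness[where i = "\<lambda>\<sigma>. \<sigma> \<circ> reversal n" and j = "\<lambda>\<sigma>. \<sigma> \<circ> reversal n"])
  fix \<sigma> assume "\<sigma> \<in> {\<sigma>. \<sigma> permutes {1..n}}"
  then have \<sigma>: "\<sigma> permutes {1..n}" by simp
  show "\<sigma> \<circ> reversal n \<in> {\<sigma>. \<sigma> permutes {1..n}}"
    using permutes_compose[OF reversal_permutes \<sigma>] by simp
  show "\<sigma> \<circ> reversal n \<circ> reversal n = \<sigma>"
    by (simp add: fun_eq_iff reversal_reversal)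
  have "n - 1 - (n - 1 - num_descents n \<sigma>) = num_descents n \<sigma>"
    using num_descents_le[of n \<sigma>] by simp
  then have "d_coeff n (num_descents n (\<sigma> \<circ> reversal n)) = (c_coeff n (num_descents n \<sigma>) :: 'k)"
    using c_coeff_reflect[of "n - 1 - num_descents n \<sigma>" n, where 'a = 'k]
    unfolding num_descents_reversal[OF \<sigma>] by simp
  moreover have "(\<Prod>\<epsilon>\<in>arcs G. beta_sgn \<beta> \<epsilon> (edge_sign G (\<sigma> \<circ> reversal n) \<epsilon>)) =
      (\<Prod>\<epsilon>\<in>arcs G. beta_sgn \<beta> \<epsilon> (- edge_sign G \<sigma> \<epsilon>))"
    by (intro prod.cong refl) (simp add: edge_sign_reversal[OF assms(1) V _ noloop \<sigma>])
  ultimately show "d_coeff n (num_descents n (\<sigma> \<circ> reversal n)) *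
      (\<Prod>\<epsilon>\<in>arcs G. beta_sgn \<beta> \<epsilon> (edge_sign G (\<sigma> \<circ> reversal n) \<epsilon>)) =
      c_coeff n (num_descents n \<sigma>) * (\<Prod>\<epsilon>\<in>arcs G. beta_sgn \<beta> \<epsilon> (- edge_sign G \<sigma> \<epsilon>))"
    by simp
next
  fix \<sigma> assume "\<sigma> \<in> {\<sigma>. \<sigma> permutes {1..n}}"
  then show "\<sigma> \<circ> reversal n \<in> {\<sigma>. \<sigma> permutes {1..n}}"
    using permutes_compose[OF reversal_permutes] by blast
  show "\<sigma> \<circ> reversal n \<circ> reversal n = \<sigma>"
    by (simp add: fun_eq_iff reversal_reversal)
qed

section \<open>Operator orderings and \<open>\<omega>\<^sub>c\<close>\<close>

theorem theorem10p4:
  fixes G :: "(nat, 'e) pre_digraph"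
    and \<beta> :: "'e \<Rightarrow> 'k::field_char_0"
    and n :: nat
  assumes "fin_digraph G"
    and "acyclic_quiver G"
    and "verts G = {1..n}"
    and "\<And>\<epsilon>. \<epsilon> \<in> arcs G \<Longrightarrow> head G \<epsilon> < tail G \<epsilon>"
  shows "Omega_op \<beta> n G = Omega_bar \<beta> n G \<and>
         (connected G \<longrightarrow> Omega_op \<beta> n G = omega_c \<beta> G)"
proof (intro conjI impI)
  interpret fin_digraph G by fact
  show "Omega_op \<beta> n G = Omega_bar \<beta> n G"
    by (rule Omega_op_eq_Omega_bar[OF wf_digraph_axioms assms(3)]) (use assms(4) in fastforce)
  assume conn: "connected G"
  then have "verts G \<noteq> {}" by (simp add: connected_def strongly_connected_def)
  then have "n \<ge> 1" by (simp add: assms(3))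
  have "omega_c \<beta> G = omega \<beta> G" using conn by (simp add: omega_c_def)
  also have "\<dots> = coeff (count_poly (verts G) (cut_weight (\<lambda>\<epsilon>. beta_sgn \<beta> \<epsilon> (- 1)) G)) (card (components G))"
    using is_omega_unique[OF is_omega_omega is_omega_cut_poly, of \<beta> G] assms(1) by simp
  also have "\<dots> = Omega_op \<beta> n G"
    using Omega_op_eq_coeff[OF wf_digraph_axioms assms(3) \<open>n \<ge> 1\<close> assms(4), of \<beta>]
    by (simp add: components_connected[OF conn] assms(3))
  finally show "Omega_op \<beta> n G = omega_c \<beta> G" by simp
qed

end
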